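(* Let $1<p<q<\infty$. Then the system of equations $$ \left\{ \begin{aligned} &\frac{1}{1+2x}\Big(\frac{1+2x^p}{3}\Big)^{1/p}=\frac{1}{1+2y}\Big(\frac{1+2y^q}{3}\Big)^{1/q},\\ &\frac{(1-x)(1-x^{p-1})}{1+2x^p}=\frac{(1-y)(1-y^{q-1})}{1+2y^q} \end{aligned} \right. $$ has a unique solution $(x,y)$ in the open unit square $(0,1)\times(0,1)$, and, for this $(x,y)$, the optimal hypercontractive constant of $\mathbb{Z}_3$ is $$ r_{p,q}(\mathbb{Z}_3)=\frac{(1+2x)(1-y)}{(1+2y)(1-x)}. $$ Moreover, the function $f=1+\frac{1-x}{1+2x}(\chi+\overline{\chi})$ on $\mathbb{Z}_3$ is a nontrivial $(p,q)$-critical extremizer.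
   Context: Let $\mathbb{Z}_3=\mathbb{Z}/3\mathbb{Z}$ be equipped with the uniform probability measure, and let $L^p(\mathbb{Z}_3)$ be the space of complex-valued functions on $\mathbb{Z}_3$ with $\|f\|_p=\big(\frac13\sum_{k\in\mathbb{Z}_3}|f(k)|^p\big)^{1/p}$. Let $\chi$ be the character of $\mathbb{Z}_3$ with $\chi(1)=e^{2\pi i/3}$, so that every function is uniquely $f=a_0+a_1\chi+a_2\overline{\chi}$ with $a_0,a_1,a_2\in\mathbb{C}$ (note $\chi^2=\overline{\chi}$). For $r\in[0,1]$ define $T_r(a_0+a_1\chi+a_2\overline{\chi})=a_0+ra_1\chi+ra_2\overline{\chi}$. For $1<p<q<\infty$, $r_{p,q}(\mathbb{Z}_3)\in[0,1]$ is the largest constant such that $\|T_rf\|_q\le\|f\|_p$ for all $0\le r\le r_{p,q}(\mathbb{Z}_3)$ and all $f\in L^p(\mathbb{Z}_3)$. A nontrivial $(p,q)$-critical extremizer for $\mathbb{Z}_3$ is a non-constant function $f$ on $\mathbb{Z}_3$ such that $\|T_rf\|_q=\|f\|_p$ for $r=r_{p,q}(\mathbb{Z}_3)$. *)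

theory Defs
  imports "HOL-Analysis.Analysis"
begin

text \<open>The ring type \<^typ>\<open>3\<close> is the library's integers modulo 3; its additive group
  models the cyclic group of order three, and all complex-valued functions on it lie in every
  $L^p$ for the uniform probability measure.\<close>

type_synonym Z3 = "3"

definition Lp_norm :: "real \<Rightarrow> (Z3 \<Rightarrow> complex) \<Rightarrow> real" where
  "Lp_norm p f = ((\<Sum>k\<in>UNIV. cmod (f k) powr p) / 3) powr (1 / p)"

definition chi :: "Z3 \<Rightarrow> complex" where
  "chi k = (if k = 0 then 1 else if k = 1 then cis (2 * pi / 3) else cis (2 * pi / 3) ^ 2)"

definition trig_poly :: "complex \<Rightarrow> complex \<Rightarrow> complex \<Rightarrow> Z3 \<Rightarrow> complex" where
  "trig_poly a0 a1 a2 = (\<lambda>k. a0 + a1 * chi k + a2 * cnj (chi k))"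

text \<open>The operator is given by the Fourier coefficients; lemmas \<open>trig_poly_exists_unique\<close> and
  \<open>T_op_trig_poly\<close> below identify it with the description by the expansion of \<open>f\<close>.\<close>

definition T_op :: "real \<Rightarrow> (Z3 \<Rightarrow> complex) \<Rightarrow> Z3 \<Rightarrow> complex" where
  "T_op r f =
    (let a0 = (\<Sum>k\<in>UNIV. f k) / 3;
         a1 = (\<Sum>k\<in>UNIV. f k * cnj (chi k)) / 3;
         a2 = (\<Sum>k\<in>UNIV. f k * chi k) / 3
     in trig_poly a0 (of_real r * a1) (of_real r * a2))"

definition hypercontractive_up_to :: "real \<Rightarrow> real \<Rightarrow> real \<Rightarrow> bool" where
  "hypercontractive_up_to p q R \<longleftrightarrow> 0 \<le> R \<and> R \<le> 1 \<and>
     (\<forall>r f. 0 \<le> r \<and> r \<le> R \<longrightarrow> Lp_norm q (T_op r f) \<le> Lp_norm p f)"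

text \<open>The largest such constant exists whenever $1 < p < q$, see
  \<open>hypercontractive_const_greatest\<close> below.\<close>

definition hypercontractive_const :: "real \<Rightarrow> real \<Rightarrow> real" where
  "hypercontractive_const p q = (GREATEST R. hypercontractive_up_to p q R)"

definition nontrivial_critical_extremizer :: "real \<Rightarrow> real \<Rightarrow> (Z3 \<Rightarrow> complex) \<Rightarrow> bool" where
  "nontrivial_critical_extremizer p q f \<longleftrightarrow>
     \<not> (\<exists>c. \<forall>k. f k = c) \<and>
     Lp_norm q (T_op (hypercontractive_const p q) f) = Lp_norm p f"

definition critical_system :: "real \<Rightarrow> real \<Rightarrow> real \<Rightarrow> real \<Rightarrow> bool" where
  "critical_system p q x y \<longleftrightarrow>
     1 / (1 + 2 * x) * ((1 + 2 * x powr p) / 3) powr (1 / p) =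
     1 / (1 + 2 * y) * ((1 + 2 * y powr q) / 3) powr (1 / q) \<and>
     (1 - x) * (1 - x powr (p - 1)) / (1 + 2 * x powr p) =
     (1 - y) * (1 - y powr (q - 1)) / (1 + 2 * y powr q)"

lemma exhaust_Z3: "(k::Z3) = 0 \<or> k = 1 \<or> k = 2"
  using exhaust_3[of k] by auto

lemma Z3_neq [simp]: "(0::Z3) \<noteq> 2" "(2::Z3) \<noteq> 0" "(1::Z3) \<noteq> 2" "(2::Z3) \<noteq> 1"
  by simp_all

lemma sum_Z3: "(\<Sum>k\<in>(UNIV::Z3 set). g k) = g 0 + g 1 + g 2"
proof -
  have "(3::Z3) = 0" by simp
  then show ?thesis by (simp only: sum_3 add_ac)
qed

lemma chi_values: "chi 0 = 1" "chi 1 = Complex (- 1 / 2) (sqrt 3 / 2)"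
    "chi 2 = Complex (- 1 / 2) (- sqrt 3 / 2)"
proof -
  have w: "cis (2 * pi / 3) = Complex (- 1 / 2) (sqrt 3 / 2)"
    using cos_120 sin_120 by (simp add: complex_eq_iff)
  show "chi 0 = 1" "chi 1 = Complex (- 1 / 2) (sqrt 3 / 2)"
    "chi 2 = Complex (- 1 / 2) (- sqrt 3 / 2)"
    unfolding chi_def w by (simp_all add: complex_eq_iff power2_eq_square)
qed

lemma chi_add: "chi (j + k) = chi j * chi k"
proof -
  have e: "(1::Z3) + 1 = 2" "(1::Z3) + 2 = 0" "(2::Z3) + 1 = 0" "(2::Z3) + 2 = 1"
    by simp_all
  consider "j = 0" | "k = 0" | "j = 1" "k = 1" | "j = 1" "k = 2" | "j = 2" "k = 1" | "j = 2" "k = 2"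
    using exhaust_Z3[of j] exhaust_Z3[of k] by blast
  then show ?thesis
    by cases (simp_all only: e chi_values, simp_all add: chi_values complex_eq_iff)
qed

lemma trig_poly_coeffs:
  "(\<Sum>k\<in>UNIV. trig_poly a0 a1 a2 k) / 3 = a0"
  "(\<Sum>k\<in>UNIV. trig_poly a0 a1 a2 k * cnj (chi k)) / 3 = a1"
  "(\<Sum>k\<in>UNIV. trig_poly a0 a1 a2 k * chi k) / 3 = a2"
  unfolding sum_Z3 trig_poly_def chi_values
  by (simp_all add: complex_eq_iff algebra_simps)

lemma T_op_trig_poly:
  "T_op r (trig_poly a0 a1 a2) = trig_poly a0 (of_real r * a1) (of_real r * a2)"
  unfolding T_op_def trig_poly_coeffs by simp

lemma trig_poly_exists_unique: "\<exists>!(a0, a1, a2). f = trig_poly a0 a1 a2"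
proof -
  have "f = trig_poly ((\<Sum>k\<in>UNIV. f k) / 3) ((\<Sum>k\<in>UNIV. f k * cnj (chi k)) / 3)
      ((\<Sum>k\<in>UNIV. f k * chi k) / 3)" (is "_ = ?g")
  proof
    fix k show "f k = ?g k"
      using exhaust_Z3[of k] unfolding sum_Z3 trig_poly_def
      by (elim disjE) (simp_all add: chi_values complex_eq_iff field_simps)
  qed
  moreover have "z = (b0, b1, b2)"
    if "case z of (a0, a1, a2) \<Rightarrow> f = trig_poly a0 a1 a2" "f = trig_poly b0 b1 b2"
    for z b0 b1 b2
  proof -
    obtain a0 a1 a2 where z: "z = (a0, a1, a2)" by (cases z)
    then have "trig_poly a0 a1 a2 = trig_poly b0 b1 b2" using that by simp
    then show ?thesis
      unfolding z using trig_poly_coeffs by (metis (no_types))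
  qed
  ultimately show ?thesis
    by (intro ex1I) (simp only: prod.case, blast)
qed

lemma powr_ge_tangent:
  fixes x p :: real
  assumes "1 < p" "0 \<le> x"
  shows "1 + p * (x - 1) \<le> x powr p"
proof (cases "x = 0")
  case False
  have "p * (x - 1) \<le> x powr p - 1 powr p"
    by (rule convex_on_imp_above_tangent[of "{0<..}"])
      (use assms False in \<open>auto intro!: powr_convex derivative_eq_intros simp: interior_open\<close>)
  then show ?thesis by simp
qed (use assms in simp)

lemma norm_mean_le_Lp_norm:
  assumes "1 < p"
  shows "cmod ((\<Sum>k\<in>UNIV. f k) / 3) \<le> Lp_norm p f"
proof -
  define m where "m = (\<Sum>k\<in>UNIV. cmod (f k)) / 3"
  have le: "cmod ((\<Sum>k\<in>UNIV. f k) / 3) \<le> m"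
    unfolding m_def by (simp add: norm_divide divide_right_mono norm_sum)
  show ?thesis
  proof (cases "m \<le> 0")
    case True
    with le have "cmod ((\<Sum>k\<in>UNIV. f k) / 3) \<le> 0" by linarith
    also have "0 \<le> Lp_norm p f" by (simp add: Lp_norm_def)
    finally show ?thesis .
  next
    case False
    have "1 + p * (cmod (f k) / m - 1) \<le> cmod (f k) powr p / m powr p" for k
      using powr_ge_tangent[OF assms, of "cmod (f k) / m"] False
      by (simp add: powr_divide)
    then have "(\<Sum>k\<in>(UNIV::Z3 set). 1 + p * (cmod (f k) / m - 1)) \<le> (\<Sum>k\<in>UNIV. cmod (f k) powr p / m powr p)"
      by (intro sum_mono)
    also have "(\<Sum>k\<in>(UNIV::Z3 set). 1 + p * (cmod (f k) / m - 1)) = 3"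
    proof -
      have "cmod (f 0) / m + cmod (f 1) / m + cmod (f 2) / m = 3"
      proof -
        have "cmod (f 0) + cmod (f 1) + cmod (f 2) = 3 * m" by (simp add: m_def sum_Z3)
        then show ?thesis using False by (simp flip: add_divide_distrib)
      qed
      then have "p * (cmod (f 0) / m + cmod (f 1) / m + cmod (f 2) / m) = p * 3" by simp
      then show ?thesis unfolding sum_Z3 by (simp add: algebra_simps)
    qed
    finally have "m powr p \<le> (\<Sum>k\<in>UNIV. cmod (f k) powr p) / 3"
      using False by (simp add: sum_divide_distrib[symmetric] field_simps)
    then have "(m powr p) powr (1 / p) \<le> Lp_norm p f"
      unfolding Lp_norm_def using assms by (intro powr_mono2) auto
    then have "m \<le> Lp_norm p f"
      using False assms by (simp add: powr_powr)
    with le show ?thesis by linarith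
  qed
qed

lemma hypercontractive_const_greatest:
  assumes "1 < p" "p < q"
  shows "hypercontractive_up_to p q (hypercontractive_const p q)"
    and "hypercontractive_up_to p q R \<Longrightarrow> R \<le> hypercontractive_const p q"
proof -
  define C where "C = (\<Inter>f. {r. Lp_norm q (T_op r f) \<le> Lp_norm p f})"
  define S where "S = {R. hypercontractive_up_to p q R}"
  have "closed C"
    unfolding C_def Lp_norm_def T_op_def Let_def trig_poly_def
    by (intro closed_INT ballI closed_Collect_le continuous_on_powr' continuous_intros)
      (use assms in \<open>auto intro!: sum_nonneg\<close>)
  have "Lp_norm q (T_op 0 f) \<le> Lp_norm p f" for f
  proof -
    have "Lp_norm q (T_op 0 f) = cmod ((\<Sum>k\<in>UNIV. f k) / 3)"
      unfolding Lp_norm_def T_op_def Let_def trig_poly_def using assms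
      by (simp add: powr_powr)
    then show ?thesis using norm_mean_le_Lp_norm[OF assms(1), of f] by simp
  qed
  then have "0 \<in> S"
    by (auto simp: S_def hypercontractive_up_to_def antisym_conv)
  have bdd: "bdd_above S"
    by (rule bdd_aboveI[of _ 1]) (auto simp: S_def hypercontractive_up_to_def)
  have "S \<subseteq> C"
    by (auto simp: S_def C_def hypercontractive_up_to_def)
  then have "Sup S \<in> C"
    using closure_contains_Sup[OF _ bdd] \<open>0 \<in> S\<close> closure_minimal[OF _ \<open>closed C\<close>] by blast
  have "hypercontractive_up_to p q (Sup S)"
    unfolding hypercontractive_up_to_def
  proof (intro conjI allI impI)
    show "0 \<le> Sup S" using cSup_upper[OF \<open>0 \<in> S\<close> bdd] .
    show "Sup S \<le> 1"
    proof (rule cSup_least)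
      show "S \<noteq> {}" using \<open>0 \<in> S\<close> by blast
    qed (simp add: S_def hypercontractive_up_to_def)
    fix r f assume r: "0 \<le> r \<and> r \<le> Sup S"
    show "Lp_norm q (T_op r f) \<le> Lp_norm p f"
    proof (cases "r = Sup S")
      case True
      then show ?thesis using \<open>Sup S \<in> C\<close> by (auto simp: C_def)
    next
      case False
      with r have "r < Sup S" by simp
      then obtain R where "R \<in> S" "r < R"
        using less_cSup_iff[OF _ bdd] \<open>0 \<in> S\<close> by blast
      then show ?thesis using r by (auto simp: S_def hypercontractive_up_to_def)
    qed
  qed
  moreover have up: "R \<le> Sup S" if "hypercontractive_up_to p q R" for R
    using that by (intro cSup_upper bdd) (simp add: S_def)
  ultimately have eq: "hypercontractive_const p q = Sup S"
    unfolding hypercontractive_const_def by (intro Greatest_equality) auto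
  show "hypercontractive_up_to p q (hypercontractive_const p q)"
    unfolding eq by fact
  show "hypercontractive_up_to p q R \<Longrightarrow> R \<le> hypercontractive_const p q"
    unfolding eq by (rule up)
qed

end

theory Submission
  imports Defs
begin

text \<open>For \<open>0 \<le> r \<le> 1\<close> the operator is positive, so \<open>f\<close> may be taken nonnegative. The ratio of the two
  norms attains its maximum at some \<open>f\<close>. Its Euler-Lagrange equations say that all three values of
  \<open>f\<close> solve one scalar equation, which a convexity argument shows to have at most two solutions; so
  \<open>f\<close> is proportional to \<open>(1, x, x)\<close> up to order.

  On this curve put \<open>x = exp (- s)\<close>. Criticality becomes \<open>el s = (p - 1) * s\<close>, where
  \<open>el = (\<lambda>s. psi ((q - 1) * psi s))\<close> and \<open>psi\<close> is the Moebius map induced by the operator, read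
  in the logarithmic coordinate. The derivative of \<open>el\<close> is strictly quasi-concave, and this leaves
  no room for two critical points at which the norms agree. As the norm ratio is strictly increasing
  in \<open>r\<close>, the solution is unique and its \<open>r\<close> is optimal. Existence follows by taking the least \<open>r\<close>
  at which the norms agree somewhere off the constants.\<close>

section \<open>The induced Moebius map\<close>

text \<open>\<open>T_op r\<close> maps the function with values \<open>(1, x, x)\<close> to a multiple of
  \<open>(1, phi r x, phi r x)\<close>.\<close>

definition phi :: "real \<Rightarrow> real \<Rightarrow> real" where
  "phi r x = (1 - r + (2 + r) * x) / (1 + 2 * r + 2 * (1 - r) * x)"

definition psi :: "real \<Rightarrow> real \<Rightarrow> real" where
  "psi r s = - ln (phi r (exp (- s)))"

text \<open>Numerator times denominator of \<open>phi r x\<close>, divided by \<open>x\<close>, at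
  \<open>x = exp (- s)\<close>; the slope of \<open>psi r\<close> is \<open>9 * r\<close> over
  this.\<close>

definition psi_den :: "real \<Rightarrow> real \<Rightarrow> real" where
  "psi_den r s = (1 - r) * (1 + 2 * r) * exp s + (4 + r + 4 * r\<^sup>2)
     + 2 * (2 + r) * (1 - r) * exp (- s)"

text \<open>For \<open>0 < r\<close> this is the logarithmic derivative of
  \<open>9 * r / psi_den r s\<close>, the slope of \<open>psi r\<close>.\<close>

definition psi_log_slope :: "real \<Rightarrow> real \<Rightarrow> real" where
  "psi_log_slope r s =
     (2 * (2 + r) * (1 - r) * exp (- s) - (1 - r) * (1 + 2 * r) * exp s) / psi_den r s"

lemma phi_pos:
  assumes "0 \<le> r" "r \<le> 1" "0 < x"
  shows "0 < 1 - r + (2 + r) * x" "0 < 1 + 2 * r + 2 * (1 - r) * x" "0 < phi r x"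
proof -
  show 1: "0 < 1 - r + (2 + r) * x"
    using assms by (intro add_nonneg_pos[OF _ mult_pos_pos]) auto
  show 2: "0 < 1 + 2 * r + 2 * (1 - r) * x"
    using assms by (intro add_pos_nonneg mult_nonneg_nonneg) auto
  show "0 < phi r x" unfolding phi_def using 1 2 by simp
qed

lemma psi_den_pos:
  assumes "0 \<le> r" "r \<le> 1"
  shows "0 < psi_den r s"
  unfolding psi_den_def using assms
  by (intro add_pos_nonneg add_nonneg_pos mult_nonneg_nonneg) auto

lemma psi_0 [simp]: "0 \<le> r \<Longrightarrow> psi r 0 = 0"
  by (simp add: psi_def phi_def)

lemma psi_has_deriv [derivative_intros]:
  assumes "0 \<le> r" "r \<le> 1"
  shows "(psi r has_real_derivative 9 * r / psi_den r s) (at s)"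
proof -
  define x where "x = exp (- s)"
  have x: "0 < x" "exp s = 1 / x" by (auto simp: x_def exp_minus field_simps)
  note pos = phi_pos[OF assms x(1)]
  have den: "psi_den r s * x = (1 - r + (2 + r) * x) * (1 + 2 * r + 2 * (1 - r) * x)"
    unfolding psi_den_def x_def[symmetric] x(2) using x(1)
    by (simp add: field_simps power2_eq_square)
  have "(psi r has_real_derivative
     - (((2 + r) * (- x) * (1 + 2 * r + 2 * (1 - r) * x) - (1 - r + (2 + r) * x) * (2 * (1 - r) * (- x)))
       / (1 + 2 * r + 2 * (1 - r) * x)\<^sup>2 / phi r x)) (at s)"
    unfolding psi_def[abs_def] phi_def x_def
    apply (rule derivative_eq_intros refl | (use pos in \<open>simp add: x_def\<close>; fail))+
    by (simp add: power2_eq_square mult_ac)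
  also have "- (((2 + r) * (- x) * (1 + 2 * r + 2 * (1 - r) * x) - (1 - r + (2 + r) * x) * (2 * (1 - r) * (- x)))
       / (1 + 2 * r + 2 * (1 - r) * x)\<^sup>2 / phi r x)
     = 9 * r * x / ((1 - r + (2 + r) * x) * (1 + 2 * r + 2 * (1 - r) * x))"
  proof -
    have "(2 + r) * (- x) * (1 + 2 * r + 2 * (1 - r) * x) - (1 - r + (2 + r) * x) * (2 * (1 - r) * (- x))
      = - (9 * r * x)" by (simp add: algebra_simps power2_eq_square)
    then show ?thesis unfolding phi_def using pos by (simp add: power2_eq_square)
  qed
  also have "\<dots> = 9 * r / psi_den r s"
    unfolding den[symmetric] using x(1) by simp
  finally show ?thesis .
qed

lemma psi_strict_mono:
  assumes "0 < r" "r \<le> 1" "s < t"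
  shows "psi r s < psi r t"
  by (rule DERIV_pos_imp_increasing[OF \<open>s < t\<close>])
    (use assms psi_den_pos[of r] psi_has_deriv[of r] in \<open>auto intro!: exI divide_pos_pos\<close>)

lemma psi_den_has_deriv:
  "(psi_den r has_real_derivative
     (1 - r) * (1 + 2 * r) * exp s - 2 * (2 + r) * (1 - r) * exp (- s)) (at s)"
  unfolding psi_den_def[abs_def] by (auto intro!: derivative_eq_intros)

text \<open>For \<open>0 < r\<close> this is strict log-concavity of the slope of
  \<open>psi r\<close>. After clearing denominators, the difference is a positive combination of
  differences of exponentials.\<close>

lemma psi_log_slope_decreasing:
  assumes "0 \<le> r" "r < 1" "s < t"
  shows "psi_log_slope r t < psi_log_slope r s"
proof -
  define a b c where "a = (1 - r) * (1 + 2 * r)" and "b = 4 + r + 4 * r\<^sup>2"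
    and "c = 2 * (2 + r) * (1 - r)"
  have abc: "0 < a" "0 < b" "0 < c"
    using assms unfolding a_def b_def c_def by (auto intro!: mult_pos_pos add_pos_nonneg)
  have pos: "0 < psi_den r s" "0 < psi_den r t" using assms psi_den_pos[of r] by auto
  have e: "exp s < exp t" "exp (- t) < exp (- s)" using assms by auto
  have m1: "exp s * exp (- t) < exp t * exp (- s)"
    using e by (intro mult_strict_mono) auto
  have "(c * exp (- t) - a * exp t) * (a * exp s + b + c * exp (- s))
      < (c * exp (- s) - a * exp s) * (a * exp t + b + c * exp (- t))"
  proof -
    have "(c * exp (- s) - a * exp s) * (a * exp t + b + c * exp (- t))
        - (c * exp (- t) - a * exp t) * (a * exp s + b + c * exp (- s))
      = 2 * a * c * (exp t * exp (- s) - exp s * exp (- t))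
        + b * c * (exp (- s) - exp (- t)) + a * b * (exp t - exp s)"
      by (simp add: algebra_simps)
    also have "\<dots> > 0" using abc e m1 by (intro add_pos_pos mult_pos_pos) auto
    finally show ?thesis by simp
  qed
  then show ?thesis
    unfolding psi_log_slope_def using pos
    by (simp add: divide_simps) (simp add: psi_den_def a_def b_def c_def)
qed

text \<open>The Euler-Lagrange equation equates a power of \<open>f\<close>, up to a constant, with
  the self-adjoint operator applied to a power of \<open>T_op r f\<close>. Hence
  \<open>psi r\<close> occurs twice, with the factor \<open>q - 1\<close> in between.\<close>

definition el :: "real \<Rightarrow> real \<Rightarrow> real \<Rightarrow> real" where
  "el q r s = psi r ((q - 1) * psi r s)"

definition el_deriv :: "real \<Rightarrow> real \<Rightarrow> real \<Rightarrow> real" where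
  "el_deriv q r s = 9 * r / psi_den r ((q - 1) * psi r s) * ((q - 1) * (9 * r / psi_den r s))"

lemma el_has_deriv:
  assumes "0 \<le> r" "r \<le> 1"
  shows "(el q r has_real_derivative el_deriv q r s) (at s)"
proof -
  have "((\<lambda>s. (q - 1) * psi r s) has_real_derivative (q - 1) * (9 * r / psi_den r s)) (at s)"
    using psi_has_deriv[OF assms] by (intro DERIV_cmult)
  from DERIV_chain2[OF psi_has_deriv[OF assms] this] show ?thesis
    unfolding el_def[abs_def] el_deriv_def .
qed

lemma el_0 [simp]: "0 \<le> r \<Longrightarrow> el q r 0 = 0"
  by (simp add: el_def)

text \<open>The logarithmic derivative of \<open>el_deriv q r\<close> with its positive factor
  \<open>9 * r / psi_den r s\<close> divided out; for \<open>0 < r < 1\<close> and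
  \<open>1 < q\<close> what remains is a sum of two decreasing terms.\<close>

definition el_den_slope :: "real \<Rightarrow> real \<Rightarrow> real \<Rightarrow> real" where
  "el_den_slope q r s =
     (2 * (2 + r) * (1 - r) * exp (- s) - (1 - r) * (1 + 2 * r) * exp s) / (9 * r)
     + (q - 1) * psi_log_slope r ((q - 1) * psi r s)"

lemma el_den_slope_decreasing:
  assumes "0 < r" "r < 1" "1 < q" "s < t"
  shows "el_den_slope q r t < el_den_slope q r s"
proof -
  have "2 * (2 + r) * (1 - r) * exp (- t) - (1 - r) * (1 + 2 * r) * exp t
      < 2 * (2 + r) * (1 - r) * exp (- s) - (1 - r) * (1 + 2 * r) * exp s"
    using assms by (intro diff_strict_mono mult_strict_left_mono mult_pos_pos) auto
  moreover have "psi_log_slope r ((q - 1) * psi r t) < psi_log_slope r ((q - 1) * psi r s)"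
    using assms psi_strict_mono[of r s t] by (intro psi_log_slope_decreasing) auto
  ultimately show ?thesis
    unfolding el_den_slope_def using assms
    by (intro add_strict_mono mult_strict_left_mono divide_strict_right_mono) auto
qed

lemma el_deriv_has_deriv:
  assumes "0 < r" "r \<le> 1"
  shows "(el_deriv q r has_real_derivative
    el_deriv q r s * (9 * r / psi_den r s) * el_den_slope q r s) (at s)"
proof -
  have pos: "psi_den r u \<noteq> 0" for u using psi_den_pos[of r u] assms by auto
  have d1: "((\<lambda>s. (q - 1) * psi r s) has_real_derivative (q - 1) * (9 * r / psi_den r s)) (at s)"
    using psi_has_deriv[of r] assms by (intro DERIV_cmult) auto
  note d2 = DERIV_chain2[OF psi_den_has_deriv d1]
  show ?thesis
    unfolding el_deriv_def[abs_def]
    apply (rule derivative_eq_intros d2 psi_den_has_deriv refl pos)+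
    using pos[of s] pos[of "(q - 1) * psi r s"] assms
    apply (simp add: el_den_slope_def psi_log_slope_def el_deriv_def)
    apply (simp add: divide_simps)
    apply (simp add: algebra_simps)
    done
qed

text \<open>The logarithmic derivative of \<open>el_deriv\<close> is a positive function times a decreasing one.\<close>

lemma el_deriv_quasi_concave:
  assumes r: "0 < r" "r < 1" and "1 < q" "s < t" "t < u"
  shows "el_deriv q r s < el_deriv q r t \<or> el_deriv q r u < el_deriv q r t"
proof -
  have pos: "0 < el_deriv q r z * (9 * r / psi_den r z)" for z
    unfolding el_deriv_def using assms psi_den_pos[of r] by (intro mult_pos_pos divide_pos_pos) auto
  note d = el_deriv_has_deriv[of r q]
  have dec: "el_den_slope q r z < el_den_slope q r y" if "y < z" for y z
    using el_den_slope_decreasing[of r q y z] assms that by auto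
  show ?thesis
  \<comment> \<open>The decreasing factor is positive before \<open>t\<close> or negative after
    \<open>t\<close>, according to its sign at \<open>t\<close>.\<close>
  proof (cases "0 \<le> el_den_slope q r t")
    case True
    have "el_deriv q r s < el_deriv q r t"
    proof (rule DERIV_pos_imp_increasing_open[OF \<open>s < t\<close>])
      fix z assume "s < z" "z < t"
      then have "0 < el_den_slope q r z" using dec[of z t] True by linarith
      then show "\<exists>y. (el_deriv q r has_real_derivative y) (at z) \<and> 0 < y"
        using d[of z] mult_pos_pos[OF pos[of z]] r by auto
    qed (use d r in \<open>auto intro!: continuous_at_imp_continuous_on DERIV_isCont\<close>)
    then show ?thesis ..
  next
    case False
    have "el_deriv q r u < el_deriv q r t"
    proof (rule DERIV_neg_imp_decreasing_open[OF \<open>t < u\<close>])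
      fix z assume "t < z" "z < u"
      then have "el_den_slope q r z < 0" using dec[of t z] False by linarith
      then show "\<exists>y. (el_deriv q r has_real_derivative y) (at z) \<and> y < 0"
        using d[of z] mult_pos_neg[OF pos[of z]] r by auto
    qed (use d r in \<open>auto intro!: continuous_at_imp_continuous_on DERIV_isCont\<close>)
    then show ?thesis ..
  qed
qed

text \<open>Its sign is that of the derivative of the norm ratio in \<open>s\<close>, and its zeros
  are the critical points on the curve.\<close>

definition excess :: "real \<Rightarrow> real \<Rightarrow> real \<Rightarrow> real \<Rightarrow> real" where
  "excess p q r s = el q r s - (p - 1) * s"

lemma excess_has_deriv:
  assumes "0 \<le> r" "r \<le> 1"
  shows "(excess p q r has_real_derivative el_deriv q r s - (p - 1)) (at s)"
  unfolding excess_def[abs_def]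
  by (rule derivative_eq_intros el_has_deriv assms refl)+ simp

text \<open>A rise, a fall and another rise would, by the mean value theorem, put a nonpositive
  slope between two nonnegative ones, which quasi-concavity of \<open>el_deriv\<close>
  forbids.\<close>

lemma excess_no_zigzag:
  assumes "0 < r" "r < 1" "1 < q" "t0 < t1" "t1 < t2" "t2 < t3"
    and "excess p q r t0 \<le> excess p q r t1" "excess p q r t2 \<le> excess p q r t1"
    and "excess p q r t2 \<le> excess p q r t3"
  shows False
proof -
  let ?D = "excess p q r" and ?D' = "\<lambda>s. el_deriv q r s - (p - 1)"
  have d: "\<And>s. (?D has_real_derivative ?D' s) (at s)" using excess_has_deriv assms by auto
  obtain a where a: "t0 < a" "a < t1" "?D t1 - ?D t0 = (t1 - t0) * ?D' a"
    using MVT2[OF \<open>t0 < t1\<close>, of ?D ?D'] d by blast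
  obtain b where b: "t1 < b" "b < t2" "?D t2 - ?D t1 = (t2 - t1) * ?D' b"
    using MVT2[OF \<open>t1 < t2\<close>, of ?D ?D'] d by blast
  obtain c where c: "t2 < c" "c < t3" "?D t3 - ?D t2 = (t3 - t2) * ?D' c"
    using MVT2[OF \<open>t2 < t3\<close>, of ?D ?D'] d by blast
  have "0 \<le> (t1 - t0) * ?D' a" "(t2 - t1) * ?D' b \<le> 0" "0 \<le> (t3 - t2) * ?D' c"
    using a b c assms by linarith+
  then have "0 \<le> ?D' a" "?D' b \<le> 0" "0 \<le> ?D' c"
    using assms by (auto simp: zero_le_mult_iff mult_le_0_iff)
  moreover have "?D' a < ?D' b \<or> ?D' c < ?D' b"
    using el_deriv_quasi_concave[of r q a b c] assms a b c by auto
  ultimately show False by linarith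
qed

lemma excess_0 [simp]: "0 \<le> r \<Longrightarrow> excess p q r 0 = 0"
  by (simp add: excess_def)

section \<open>The norm ratio on the curve of two-valued functions\<close>

text \<open>The logarithm of the ratio of the norms of \<open>T_op r f\<close> and \<open>f\<close>, for \<open>f\<close> with values
  \<open>(1, x, x)\<close>.\<close>

definition log_gap :: "real \<Rightarrow> real \<Rightarrow> real \<Rightarrow> real \<Rightarrow> real" where
  "log_gap p q r x =
     ln ((((1 + 2 * r + 2 * (1 - r) * x) / 3) powr q + 2 * ((1 - r + (2 + r) * x) / 3) powr q) / 3) / q
     - ln ((1 + 2 * x powr p) / 3) / p"

abbreviation gap :: "real \<Rightarrow> real \<Rightarrow> real \<Rightarrow> real \<Rightarrow> real" where
  "gap p q r s \<equiv> log_gap p q r (exp (- s))"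

lemma log_gap_1 [simp]: "log_gap p q r 1 = 0"
  by (simp add: log_gap_def)

lemma exp_minus_el:
  assumes "0 \<le> r" "r \<le> 1"
  shows "exp (- el q r s) = phi r (phi r (exp (- s)) powr (q - 1))"
proof -
  have "0 < phi r (exp (- s))" using assms by (intro phi_pos) auto
  then have "exp (- ((q - 1) * psi r s)) = phi r (exp (- s)) powr (q - 1)"
    by (simp add: psi_def powr_def)
  moreover have "exp (- el q r s) = phi r (exp (- ((q - 1) * psi r s)))"
    unfolding el_def psi_def[of r "(q - 1) * psi r s"]
    using assms phi_pos(3)[of r "exp (- ((q - 1) * psi r s))"] by simp
  ultimately show ?thesis by simp
qed

lemma DERIV_ln_third_divide:
  fixes f :: "real \<Rightarrow> real"
  assumes "(f has_real_derivative D) (at x)" "0 < f x"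
  shows "((\<lambda>x. ln (f x / 3) / c) has_real_derivative D / f x / c) (at x)"
  using DERIV_cdivide[OF DERIV_chain2[OF DERIV_ln_divide DERIV_cdivide[OF assms(1), of 3]], of c]
    assms(2) by simp

text \<open>Only the sign of the derivative matters later, so the positive factor \<open>K\<close>
  stays unspecified.\<close>

lemma log_gap_has_deriv:
  assumes "0 \<le> r" "r \<le> 1" "1 < p" "1 < q" "0 < x"
  shows "\<exists>K>0. (log_gap p q r has_real_derivative
     K * (phi r (phi r x powr (q - 1)) - x powr (p - 1))) (at x)"
proof -
  define B S where "B = (1 + 2 * r + 2 * (1 - r) * x) / 3" and "S = (1 - r + (2 + r) * x) / 3"
  have pos: "0 < B" "0 < S" using phi_pos[OF assms(1,2,5)] by (auto simp: B_def S_def)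
  define b1 s1 X Y where "b1 = B powr (q - 1)" and "s1 = S powr (q - 1)"
    and "X = x powr (p - 1)" and "Y = phi r x powr (q - 1)"
  have pos1: "0 < b1" "0 < s1" "0 < X" "0 < Y"
    using pos assms phi_pos[OF assms(1,2,5)] by (auto simp: b1_def s1_def X_def Y_def)
  have "1 - r + (2 + r) * x = 3 * S" "1 + 2 * r + 2 * (1 - r) * x = 3 * B"
    by (simp_all add: B_def S_def)
  then have "phi r x = S / B" by (simp add: phi_def)
  then have Y: "s1 = Y * b1" using pos by (simp add: Y_def s1_def b1_def powr_divide)
  have pw: "B powr q = B * b1" "S powr q = S * s1" "x powr p = x * X"
    using pos assms by (auto simp: b1_def s1_def X_def powr_diff)
  define P W where "P = 1 + 2 * x powr p" and "W = B powr q + 2 * S powr q"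
  have pos2: "0 < P" "0 < W" using pos by (auto simp: P_def W_def add_pos_pos add_pos_nonneg)
  have "((\<lambda>x. (1 + 2 * r + 2 * (1 - r) * x) / 3) has_real_derivative 2 * (1 - r) / 3) (at x)"
    "((\<lambda>x. (1 - r + (2 + r) * x) / 3) has_real_derivative (2 + r) / 3) (at x)"
    by (auto intro!: derivative_eq_intros)
  note d = DERIV_fun_powr[OF this(1), of q, folded B_def] DERIV_fun_powr[OF this(2), of q, folded S_def]
    DERIV_fun_powr[OF DERIV_ident, of x p]
  have "(log_gap p q r has_real_derivative
      (q * b1 * (2 * (1 - r) / 3) + 2 * (q * s1 * ((2 + r) / 3))) / W / q - 2 * (p * X) / P / p) (at x)"
    unfolding log_gap_def[abs_def]
    using DERIV_diff[OF
      DERIV_ln_third_divide[OF DERIV_add[OF d(1) DERIV_cmult[OF d(2), of 2]], of q]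
      DERIV_ln_third_divide[OF DERIV_add[OF DERIV_const[of 1] DERIV_cmult[OF d(3), of 2]], of p]]
      pos pos2 assms
    by (simp add: b1_def s1_def X_def W_def P_def B_def S_def)
  also have "(q * b1 * (2 * (1 - r) / 3) + 2 * (q * s1 * ((2 + r) / 3))) / W / q - 2 * (p * X) / P / p = (2 * (1 - r) / 3 * b1 + 2 * (2 + r) / 3 * s1) / W - 2 * X / P"
    using assms pos2 by (simp add: field_simps)
  also have "(2 * (1 - r) / 3 * b1 + 2 * (2 + r) / 3 * s1) / W - 2 * X / P
     = 2 / 3 * b1 * (1 + 2 * r + 2 * (1 - r) * Y) / (P * W) * (phi r Y - X)"
  proof -
    have "1 + 2 * r + 2 * (1 - r) * Y > 0" using phi_pos(2)[OF assms(1,2) pos1(4)] .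
    then have phi: "(1 + 2 * r + 2 * (1 - r) * Y) * (phi r Y - X)
        = (1 - r + (2 + r) * Y) - X * (1 + 2 * r + 2 * (1 - r) * Y)"
      by (simp add: phi_def field_simps)
    have PW: "P = 1 + 2 * (x * X)" "W = B * b1 + 2 * (S * (Y * b1))"
      by (simp_all add: P_def W_def pw Y)
    \<comment> \<open>\<open>B\<close> and \<open>S\<close> are affine in \<open>x\<close>; the
      terms containing \<open>x * X\<close> cancel and leave a multiple of
      \<open>phi r Y - X\<close>.\<close>
    have num: "(2 * (1 - r) / 3 * b1 + 2 * (2 + r) / 3 * (Y * b1)) * P - 2 * X * W
       = 2 / 3 * b1 * ((1 + 2 * r + 2 * (1 - r) * Y) * (phi r Y - X))"
      unfolding phi PW B_def S_def by (simp add: field_simps)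
    have frac: "n / W - 2 * X / P = (n * P - 2 * X * W) / (P * W)" for n
      using pos2 by (simp add: diff_frac_eq mult.commute)
    show ?thesis unfolding Y frac num by (simp add: mult.assoc)
  qed
  finally have "(log_gap p q r has_real_derivative 2 / 3 * b1 * (1 + 2 * r + 2 * (1 - r) * Y) / (P * W)
     * (phi r (phi r x powr (q - 1)) - x powr (p - 1))) (at x)"
    unfolding Y_def X_def .
  moreover have "0 < 2 / 3 * b1 * (1 + 2 * r + 2 * (1 - r) * Y) / (P * W)"
    using pos1 pos2 phi_pos(2)[OF assms(1,2) pos1(4)] by (intro divide_pos_pos mult_pos_pos) auto
  ultimately show ?thesis by blast
qed

lemma gap_has_deriv:
  assumes "0 \<le> r" "r \<le> 1" "1 < p" "1 < q"
  obtains K where "0 < K" "(gap p q r has_real_derivative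
     K * (exp (- ((p - 1) * s)) - exp (- el q r s))) (at s)"
proof -
  define x where "x = exp (- s)"
  have "0 < x" by (simp add: x_def)
  obtain K where K: "0 < K" "(log_gap p q r has_real_derivative
     K * (phi r (phi r x powr (q - 1)) - x powr (p - 1))) (at x)"
    using log_gap_has_deriv[OF assms \<open>0 < x\<close>] by auto
  have "((\<lambda>s. exp (- s)) has_real_derivative - x) (at s)"
    unfolding x_def by (auto intro!: derivative_eq_intros)
  from DERIV_chain2[OF K(2)[unfolded x_def] this]
  have "(gap p q r has_real_derivative
     K * x * (exp (- ((p - 1) * s)) - exp (- el q r s))) (at s)"
    unfolding exp_minus_el[OF assms(1,2)]
    by (simp add: x_def powr_def algebra_simps)
  then show ?thesis using that[of "K * x"] K(1) \<open>0 < x\<close> by simp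
qed

lemma gap_isCont:
  assumes "0 \<le> r" "r \<le> 1" "1 < p" "1 < q"
  shows "isCont (gap p q r) s"
  using gap_has_deriv[OF assms] DERIV_isCont by metis

lemma gap_increasing:
  assumes "0 \<le> r" "r \<le> 1" "1 < p" "1 < q" "s < t"
    and D: "\<And>z. s < z \<Longrightarrow> z < t \<Longrightarrow> 0 < excess p q r z"
  shows "gap p q r s < gap p q r t"
proof (rule DERIV_pos_imp_increasing_open[OF \<open>s < t\<close>])
  fix z assume z: "s < z" "z < t"
  obtain K where K: "0 < K" "(gap p q r has_real_derivative
     K * (exp (- ((p - 1) * z)) - exp (- el q r z))) (at z)"
    using gap_has_deriv[OF assms(1-4)] .
  moreover have "exp (- el q r z) < exp (- ((p - 1) * z))"
    using D[OF z] by (simp add: excess_def)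
  ultimately show "\<exists>y. (gap p q r has_real_derivative y) (at z) \<and> 0 < y"
    by (meson diff_gt_0_iff_gt mult_pos_pos)
qed (use gap_isCont[OF assms(1-4)] in \<open>auto intro: continuous_at_imp_continuous_on\<close>)

lemma gap_decreasing:
  assumes "0 \<le> r" "r \<le> 1" "1 < p" "1 < q" "s < t"
    and D: "\<And>z. s < z \<Longrightarrow> z < t \<Longrightarrow> excess p q r z < 0"
  shows "gap p q r t < gap p q r s"
proof (rule DERIV_neg_imp_decreasing_open[OF \<open>s < t\<close>])
  fix z assume z: "s < z" "z < t"
  obtain K where K: "0 < K" "(gap p q r has_real_derivative
     K * (exp (- ((p - 1) * z)) - exp (- el q r z))) (at z)"
    using gap_has_deriv[OF assms(1-4)] .
  moreover have "exp (- ((p - 1) * z)) < exp (- el q r z)"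
    using D[OF z] by (simp add: excess_def)
  ultimately show "\<exists>y. (gap p q r has_real_derivative y) (at z) \<and> y < 0"
    by (meson diff_less_0_iff_less mult_pos_neg)
qed (use gap_isCont[OF assms(1-4)] in \<open>auto intro: continuous_at_imp_continuous_on\<close>)

text \<open>Since \<open>gap\<close> agrees at \<open>0\<close> and \<open>t\<close>,
  \<open>excess\<close> takes both a nonnegative and a negative value in between. Excluding zigzags
  then fixes its signs: positive before \<open>0\<close>, first negative and then positive between
  \<open>0\<close> and \<open>t\<close>, negative after \<open>t\<close>. So \<open>0\<close> and
  \<open>t\<close> are the only maxima of \<open>gap\<close>, both with value zero.\<close>

lemma gap_negative:
  assumes r: "0 < r" "r < 1" and pq: "1 < p" "1 < q" and "0 < t"
    and gap: "gap p q r t = 0" and ex: "excess p q r t = 0"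
    and s: "s \<noteq> 0" "s \<noteq> t"
  shows "gap p q r s < 0"
proof -
  let ?D = "excess p q r" and ?g = "gap p q r"
  have r': "0 \<le> r" "r \<le> 1" using r by auto
  note incr = gap_increasing[OF r' pq] and decr = gap_decreasing[OF r' pq]
  have zigzag: "\<not> (?D a \<le> ?D b \<and> ?D c \<le> ?D b \<and> ?D c \<le> ?D d)" if "a < b" "b < c" "c < d" for a b c d
    using excess_no_zigzag[OF r pq(2) that] by blast
  have D0: "?D 0 = 0" using r by simp
  \<comment> \<open>Otherwise \<open>excess\<close> would rise from \<open>0\<close> to
    \<open>u\<close>, fall from \<open>u\<close> to \<open>v\<close> and rise again from
    \<open>v\<close> to \<open>t\<close>.\<close>
  have up: "0 < ?D v" if "0 < u" "u < v" "v < t" "0 \<le> ?D u" for u v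
    using zigzag[of 0 u v t] that D0 ex by linarith
  obtain u where u: "0 < u" "u < t" "0 \<le> ?D u"
    using decr[OF \<open>0 < t\<close>] gap by force
  obtain w where w: "0 < w" "w < t" "?D w < 0"
  proof (rule ccontr)
    assume "\<not> thesis"
    with that have nn: "0 \<le> ?D w" if "0 < w" "w < t" for w using \<open>0 < w\<close> \<open>w < t\<close> by force
    \<comment> \<open>Starting \<open>up\<close> from the midpoint \<open>w / 2\<close> upgrades
      nonnegativity to positivity, so \<open>gap\<close> would increase strictly from
      \<open>0\<close> to \<open>t\<close>.\<close>
    have "0 < ?D w" if "0 < w" "w < t" for w
      using up[of "w / 2" w] nn[of "w / 2"] that by auto
    from incr[OF \<open>0 < t\<close> this] gap show False by simp
  qed
  consider "s < 0" | "0 < s" "s < t" "0 \<le> ?D s" | "0 < s" "s < t" "?D s < 0" | "t < s"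
    using s by linarith
  then show ?thesis
  proof cases
    case 1
    have "0 < ?D z" if "z < 0" for z
      using zigzag[of z 0 w t] that w D0 ex by linarith
    then show ?thesis using incr[OF 1] by simp
  next
    case 2
    then have "?g s < ?g t" by (intro incr up) auto
    then show ?thesis using gap by simp
  next
    case 3
    then have "?D z < 0" if "0 < z" "z < s" for z
      using up[of z s] that by force
    then show ?thesis using decr[OF 3(1)] by simp
  next
    case 4
    have "?D z < 0" if "t < z" for z
      using zigzag[of 0 u t z] u that D0 ex by linarith
    then show ?thesis using decr[OF 4] gap by simp
  qed
qed

text \<open>As \<open>r\<close> grows, the values of the image move apart while their mean stays
  fixed, so the \<open>q\<close>-norm grows. Instead of \<open>r' \<le> 1\<close> only positivity of
  the image is assumed: the \<open>r\<close> read off from a solution of the system is not known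
  beforehand to be below one.\<close>

lemma log_gap_strict_mono:
  assumes "1 < q" "0 < x" "x \<noteq> 1" "0 \<le> r" "r < r'"
    and pos: "0 < 1 - r' + (2 + r') * x" "0 < 1 + 2 * r' + 2 * (1 - r') * x"
  shows "log_gap p q r x < log_gap p q r' x"
proof -
  define B S where "B = (\<lambda>r. (1 + 2 * r + 2 * (1 - r) * x) / 3)"
    and "S = (\<lambda>r. (1 - r + (2 + r) * x) / 3)"
  \<comment> \<open>Since \<open>B z - S z = z * (1 - x)\<close>, the difference of powers has the
    sign of \<open>1 - x\<close>. Positivity at \<open>r'\<close> carries back because
    \<open>B\<close> and \<open>S\<close> are affine in \<open>z\<close> and positive at
    \<open>0\<close>.\<close>
  have BS: "0 < B z \<and> 0 < S z \<and> 0 < (1 - x) * (B z powr (q - 1) - S z powr (q - 1))"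
    if "0 < z" "z \<le> r'" for z
  proof -
    have e: "B z = (1 + 2 * x + 2 * (z * (1 - x))) / 3" "S z = (1 + 2 * x - z * (1 - x)) / 3" for z
      by (auto simp: B_def S_def algebra_simps)
    show ?thesis
    proof (cases "x < 1")
      case True
      then have le: "z * (1 - x) \<le> r' * (1 - x)" and p: "0 < z * (1 - x)"
        using that by (auto intro: mult_right_mono)
      have "0 < S r'" using pos by (simp add: S_def)
      with le p \<open>0 < x\<close> have "0 < S z" "S z < B z" unfolding e by auto
      moreover from this have "S z powr (q - 1) < B z powr (q - 1)"
        using assms by (intro powr_less_mono2) auto
      ultimately show ?thesis using True by auto
    next
      case False
      then have le: "z * (x - 1) \<le> r' * (x - 1)" and p: "0 < z * (x - 1)"
        using that assms by (auto intro: mult_right_mono)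
      have "0 < B r'" using pos by (simp add: B_def)
      have e: "B z = (1 + 2 * x - 2 * (z * (x - 1))) / 3" "S z = (1 + 2 * x + z * (x - 1)) / 3" for z
        by (auto simp: B_def S_def algebra_simps)
      from le p \<open>0 < B r'\<close> \<open>0 < x\<close> have "0 < B z" "B z < S z" unfolding e by auto
      moreover from this have "B z powr (q - 1) < S z powr (q - 1)"
        using assms by (intro powr_less_mono2) auto
      ultimately show ?thesis using False assms by (auto intro: mult_neg_neg)
    qed
  qed
  have pos0: "0 < B z" "0 < S z" if "0 \<le> z" "z \<le> r'" for z
    using that BS[of z] assms by (cases "z = 0"; auto simp: B_def S_def)+
  have "B r powr q + 2 * S r powr q < B r' powr q + 2 * S r' powr q"
  proof (rule DERIV_pos_imp_increasing_open[OF \<open>r < r'\<close>, where f = "\<lambda>z. B z powr q + 2 * S z powr q"])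
    fix z assume z: "r < z" "z < r'"
    then have z': "0 < z" "z \<le> r'" using assms by auto
    have d: "(B has_real_derivative 2 * (1 - x) / 3) (at z)" "(S has_real_derivative - (1 - x) / 3) (at z)"
      unfolding B_def S_def by (auto intro!: derivative_eq_intros)
    have "((\<lambda>z. B z powr q + 2 * S z powr q) has_real_derivative
      2 * q / 3 * ((1 - x) * (B z powr (q - 1) - S z powr (q - 1)))) (at z)"
      by (rule DERIV_cong[OF DERIV_add[OF DERIV_fun_powr[OF d(1), of q]
          DERIV_cmult[OF DERIV_fun_powr[OF d(2), of q], of 2]]])
        (use BS[OF z', THEN conjunct1] BS[OF z', THEN conjunct2, THEN conjunct1] in \<open>simp_all add: field_simps\<close>)
    moreover have "0 < 2 * q / 3 * ((1 - x) * (B z powr (q - 1) - S z powr (q - 1)))"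
      using BS[OF z'] assms by (intro mult_pos_pos[of "2 * q / 3"]) auto
    ultimately show "\<exists>y. ((\<lambda>z. B z powr q + 2 * S z powr q) has_real_derivative y) (at z) \<and> 0 < y"
      by blast
  next
    show "continuous_on {r..r'} (\<lambda>z. B z powr q + 2 * S z powr q)"
    proof (intro continuous_intros)
      show "continuous_on {r..r'} B" "continuous_on {r..r'} S"
        unfolding B_def S_def by (intro continuous_intros; simp)+
      show "\<forall>x\<in>{r..r'}. B x \<noteq> 0" "\<forall>x\<in>{r..r'}. S x \<noteq> 0"
        using pos0 \<open>0 \<le> r\<close> by (metis atLeastAtMost_iff less_irrefl order_trans)+
    qed
  qed
  moreover have "0 < B r powr q + 2 * S r powr q"
    using pos0[of r] assms by (intro add_pos_nonneg) auto
  ultimately show ?thesis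
    unfolding log_gap_def B_def S_def using assms
    by (auto intro!: divide_strict_right_mono)
qed

section \<open>Existence of a critical point\<close>

lemma log_gap_continuous:
  assumes "1 < p" "1 < q"
  shows "continuous_on ({0<..} \<times> {0..1}) (\<lambda>z. log_gap p q (snd z) (fst z))"
  unfolding log_gap_def
proof (intro continuous_intros ballI)
  fix z :: "real \<times> real" assume z: "z \<in> {0<..} \<times> {0..1}"
  define x r where "x = fst z" and "r = snd z"
  have "0 \<le> r" "r \<le> 1" "0 < x" using z by (auto simp: x_def r_def)
  note pos = phi_pos[OF this]
  show "(1 + 2 * snd z + 2 * (1 - snd z) * fst z) / 3 \<noteq> 0"
    "(1 - snd z + (2 + snd z) * fst z) / 3 \<noteq> 0" "fst z \<noteq> 0"
    using pos \<open>0 < x\<close> by (auto simp: x_def r_def)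
  have "0 < ((1 + 2 * r + 2 * (1 - r) * x) / 3) powr q + 2 * ((1 - r + (2 + r) * x) / 3) powr q"
    using pos by (intro add_pos_pos) auto
  then show "(((1 + 2 * snd z + 2 * (1 - snd z) * fst z) / 3) powr q +
          2 * ((1 - snd z + (2 + snd z) * fst z) / 3) powr q) / 3 \<noteq> 0"
    unfolding x_def r_def by simp
  have "0 < 1 + 2 * x powr p" by (intro add_pos_nonneg) auto
  then show "(1 + 2 * fst z powr p) / 3 \<noteq> 0" unfolding x_def by simp
qed (use assms in auto)

lemma gap_continuous:
  assumes "1 < p" "1 < q" "A \<subseteq> UNIV \<times> {0..1}"
  shows "continuous_on A (\<lambda>z. gap p q (snd z) (fst z))"
proof -
  have "continuous_on A (\<lambda>z. log_gap p q (snd (exp (- fst z), snd z)) (fst (exp (- fst z), snd z)))"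
    by (rule continuous_on_compose2[OF log_gap_continuous[OF assms(1,2)]])
      (use assms(3) in \<open>auto intro!: continuous_intros\<close>)
  then show ?thesis by simp
qed

lemma gap_zero_between:
  assumes "1 < p" "1 < q" "0 \<le> r" "r \<le> 1" "gap p q 0 s \<le> 0" "0 \<le> gap p q r s"
  obtains r' where "0 \<le> r'" "r' \<le> r" "gap p q r' s = 0"
proof -
  have "continuous_on {0..r} (\<lambda>r. gap p q (snd (s, r)) (fst (s, r)))"
    by (rule continuous_on_compose2[OF gap_continuous[OF assms(1,2) order_refl]])
      (use assms in \<open>auto intro!: continuous_intros\<close>)
  then show ?thesis
    using IVT'[of "\<lambda>r. gap p q r s" 0 0 r] assms that by auto
qed

section \<open>Behaviour near the constant function, at \<open>r = 0\<close> and for large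
  \<open>s\<close>\<close>

lemma psi_den_0: "psi_den r 0 = 9"
  by (simp add: psi_den_def algebra_simps power2_eq_square)

lemma el_deriv_0: "0 \<le> r \<Longrightarrow> el_deriv q r 0 = (q - 1) * r\<^sup>2"
  by (simp add: el_deriv_def psi_den_0 power2_eq_square)

lemma gap_r0_negative:
  assumes "1 < p" "1 < q" "0 < s"
  shows "gap p q 0 s < 0"
proof -
  have "psi 0 y = 0" for y
  proof -
    have "0 < 1 + 2 * exp (- y)" by (intro add_pos_pos) auto
    then show ?thesis by (simp add: psi_def phi_def)
  qed
  then have "excess p q 0 z = - ((p - 1) * z)" for z
    by (simp add: excess_def el_def)
  then show ?thesis using gap_decreasing[of 0 p q 0 s] assms by simp
qed

text \<open>The last hypothesis says that \<open>excess\<close> has negative slope at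
  \<open>0\<close>; this is the second-order condition for contractivity near the constants.\<close>

lemma gap_near_0_negative:
  assumes "1 < p" "1 < q" "0 \<le> r" "r \<le> 1" "(q - 1) * r\<^sup>2 < p - 1"
  obtains d where "0 < d" "\<And>s. 0 < s \<Longrightarrow> s < d \<Longrightarrow> gap p q r s < 0"
proof -
  have "(excess p q r has_real_derivative (q - 1) * r\<^sup>2 - (p - 1)) (at 0)"
    using excess_has_deriv[of r p q 0] assms by (simp add: el_deriv_0)
  moreover have "(q - 1) * r\<^sup>2 - (p - 1) < 0" using assms by simp
  ultimately have "\<exists>d>0. \<forall>h>0. h < d \<longrightarrow> excess p q r (0 + h) < excess p q r 0"
    by (rule DERIV_neg_dec_right)
  then obtain d where d: "0 < d" "\<And>h. 0 < h \<Longrightarrow> h < d \<Longrightarrow> excess p q r h < 0"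
    using assms by auto
  show ?thesis
  proof (rule that[OF d(1)])
    fix s assume "0 < s" "s < d"
    then show "gap p q r s < 0"
      using gap_decreasing[of r p q 0 s] d(2) assms by simp
  qed
qed

text \<open>At the radius given by the second-order expansion at the constant function, the third-order
  term makes contractivity fail.\<close>

lemma gap_positive_somewhere:
  assumes "1 < p" "1 < q" "0 < r" "r < 1" "(q - 1) * r\<^sup>2 = p - 1"
  obtains s where "0 < s" "0 < gap p q r s"
proof -
  have "0 < psi_log_slope r 0" "0 < (2 * (2 + r) * (1 - r) - (1 - r) * (1 + 2 * r)) / (9 * r)"
  proof -
    have "2 * (2 + r) * (1 - r) - (1 - r) * (1 + 2 * r) = 3 * (1 - r)" by (simp add: algebra_simps)
    then show "0 < psi_log_slope r 0" "0 < (2 * (2 + r) * (1 - r) - (1 - r) * (1 + 2 * r)) / (9 * r)"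
      using assms by (simp_all add: psi_log_slope_def psi_den_0)
  qed
  then have slope: "0 < el_den_slope q r 0"
    using assms by (simp add: el_den_slope_def add_pos_pos)
  have "0 < el_deriv q r 0 * (9 * r / psi_den r 0) * el_den_slope q r 0"
    using slope assms by (simp add: psi_den_0 el_deriv_0)
  \<comment> \<open>The value of \<open>el_deriv\<close> at \<open>0\<close> is
    \<open>p - 1\<close>, so just to the right of \<open>0\<close> it exceeds \<open>p - 1\<close>
    and \<open>excess\<close> increases.\<close>
  then obtain d where d: "0 < d" "\<And>h. 0 < h \<Longrightarrow> h < d \<Longrightarrow> el_deriv q r 0 < el_deriv q r h"
    using DERIV_pos_inc_right[OF el_deriv_has_deriv[of r q 0]] assms by fastforce
  have ex: "0 < excess p q r s" if "0 < s" "s < d" for s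
  proof -
    have "excess p q r 0 < excess p q r s"
    proof (rule DERIV_pos_imp_increasing_open[OF \<open>0 < s\<close>])
      fix z assume "0 < z" "z < s"
      then have "0 < el_deriv q r z - (p - 1)"
        using d(2)[of z] that assms by (simp add: el_deriv_0)
      then show "\<exists>y. (excess p q r has_real_derivative y) (at z) \<and> 0 < y"
        using excess_has_deriv[of r p q z] assms by auto
    next
      show "continuous_on {0..s} (excess p q r)"
        using excess_has_deriv[of r p q] assms
        by (auto intro!: continuous_at_imp_continuous_on DERIV_isCont)
    qed
    then show ?thesis using assms by simp
  qed
  show ?thesis
    by (rule that[of "d / 2"]) (use gap_increasing[of r p q 0 "d / 2"] ex d assms in auto)
qed

lemma phi_lower_bound:
  assumes "0 \<le> r" "r \<le> R" "R < 1" "0 < x" "x \<le> 1"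
  shows "(1 - R) / 3 \<le> phi r x"
proof -
  have "(1 - r) * x \<le> (1 - r) * 1" using assms by (intro mult_left_mono) auto
  then have "1 + 2 * r + 2 * (1 - r) * x \<le> 3" by (simp add: algebra_simps)
  moreover have "1 - R \<le> 1 - r + (2 + r) * x"
    using assms mult_nonneg_nonneg[of "2 + r" x] by linarith
  ultimately show ?thesis
    unfolding phi_def using assms by (intro frac_le phi_pos(2)) auto
qed

text \<open>For \<open>r \<le> R < 1\<close> the values of \<open>phi r\<close> stay away from zero,
  so \<open>el q r s\<close> stays bounded while \<open>(p - 1) * s\<close> grows. The bound
  \<open>S\<close> is uniform in \<open>r\<close>, as the choice of a compact range of parameters
  requires.\<close>

lemma excess_eventually_negative:
  assumes "1 < p" "1 < q" "R < 1"
  obtains S where "0 < S" "\<And>r s. 0 < r \<Longrightarrow> r \<le> R \<Longrightarrow> S < s \<Longrightarrow> excess p q r s < 0"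
proof
  define L where "L = - ln ((1 - R) / 3)"
  show "0 < max 1 (L / (p - 1))" by simp
  fix r s assume r: "0 < r" "r \<le> R" and s: "max 1 (L / (p - 1)) < s"
  have "psi r 0 < psi r s" using r s assms by (intro psi_strict_mono) auto
  then have "0 \<le> (q - 1) * psi r s" using r assms by simp
  then have "(1 - R) / 3 \<le> phi r (exp (- ((q - 1) * psi r s)))"
    using r assms by (intro phi_lower_bound) auto
  moreover have "0 < (1 - R) / 3" using assms by simp
  ultimately have "el q r s \<le> L"
    unfolding L_def el_def psi_def[of r "(q - 1) * psi r s"]
    by (metis ln_le_cancel_iff neg_le_iff_le order_less_le_trans)
  moreover have "L < (p - 1) * s" using s assms by (simp add: field_simps)
  ultimately show "excess p q r s < 0" by (simp add: excess_def)
qed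

lemma critical_point_exists:
  assumes "1 < p" "p < q"
  obtains r t where "0 < r" "r < 1" "0 < t" "gap p q r t = 0" "excess p q r t = 0"
proof -
  have "1 < q" using assms by simp
  note pq = \<open>1 < p\<close> \<open>1 < q\<close>
  \<comment> \<open>The threshold at which the second-order term at the constants vanishes. Here
    \<open>gap\<close> is positive somewhere, so a zero occurs already at a smaller
    \<open>R\<close>, where \<open>gap\<close> is negative for small positive
    \<open>s\<close>.\<close>
  define \<rho> where "\<rho> = sqrt ((p - 1) / (q - 1))"
  have \<rho>: "0 < \<rho>" "\<rho> < 1" "(q - 1) * \<rho>\<^sup>2 = p - 1"
    using assms by (auto simp: \<rho>_def)
  obtain s0 where s0: "0 < s0" "0 < gap p q \<rho> s0"
    using gap_positive_somewhere[OF pq \<rho>] by auto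
  obtain R where R: "0 \<le> R" "R \<le> \<rho>" "gap p q R s0 = 0"
    using gap_zero_between[OF pq, of \<rho> s0] gap_r0_negative[OF pq s0(1)] s0 \<rho> by auto
  have "R \<noteq> \<rho>" using R s0 by auto
  then have R1: "R < \<rho>" "R < 1" using R \<rho> by auto
  have "R\<^sup>2 < \<rho>\<^sup>2" using R R1 by (intro power_strict_mono) auto
  then have "(q - 1) * R\<^sup>2 < p - 1" using \<rho>(3) pq mult_strict_left_mono[of "R\<^sup>2" "\<rho>\<^sup>2" "q - 1"] by simp
  then obtain d where d: "0 < d" "\<And>s. 0 < s \<Longrightarrow> s < d \<Longrightarrow> gap p q R s < 0"
    using gap_near_0_negative[OF pq R(1)] R1 by auto
  obtain S where S: "0 < S" "\<And>r s. 0 < r \<Longrightarrow> r \<le> R \<Longrightarrow> S < s \<Longrightarrow> excess p q r s < 0"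
    using excess_eventually_negative[OF pq R1(2)] by auto
  \<comment> \<open>The lower bound excludes the trivial zero at \<open>s = 0\<close>, and beyond
    \<open>S\<close> the gap decreases. Including \<open>s0\<close> puts \<open>(s0, R)\<close> into
    the zero set, which is then nonempty and compact.\<close>
  define Q where "Q = {min d s0..max S s0} \<times> {0..R}"
  define Z where "Z = {z \<in> Q. gap p q (snd z) (fst z) = 0}"
  have "compact Q" unfolding Q_def by (intro compact_Times) auto
  have "closed Z" unfolding Z_def
    using \<open>compact Q\<close> R1 by (intro continuous_closed_preimage_constant gap_continuous pq)
      (auto simp: Q_def compact_imp_closed)
  then have "compact Z"
    using \<open>compact Q\<close> by (auto simp: Z_def compact_eq_bounded_closed intro: bounded_subset)
  moreover have "(s0, R) \<in> Z" using R by (auto simp: Z_def Q_def)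
  ultimately obtain z where z: "z \<in> Z" "\<And>z'. z' \<in> Z \<Longrightarrow> snd z \<le> snd z'"
    using continuous_attains_inf[of Z snd] continuous_on_snd[OF continuous_on_id] by blast
  define t r where "t = fst z" and "r = snd z"
  have tr: "min d s0 \<le> t" "0 \<le> r" "r \<le> R" "gap p q r t = 0"
    using z(1) by (auto simp: Z_def Q_def t_def r_def)
  have "0 < t" using tr d s0 by auto
  then have "r \<noteq> 0" using tr gap_r0_negative[OF pq, of t] by auto
  then have r: "0 < r" "r < 1" using tr R1 by auto
  \<comment> \<open>A positive value would give a zero at this \<open>s\<close> for a parameter at
    most \<open>r\<close>; minimality leaves only \<open>r\<close> itself, where the value is
    positive.\<close>
  have in_range: "gap p q r s \<le> 0" if s: "min d s0 \<le> s" "s \<le> max S s0" for s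
  proof (rule ccontr)
    assume pos: "\<not> gap p q r s \<le> 0"
    have "0 < s" using s d s0 by auto
    then obtain r' where r': "0 \<le> r'" "r' \<le> r" "gap p q r' s = 0"
      using gap_zero_between[OF pq, of r s] gap_r0_negative[OF pq, of s] pos r by auto
    then have "(s, r') \<in> Z" using s tr by (auto simp: Z_def Q_def)
    from z(2)[OF this] have "r' = r" using r' by (simp add: r_def)
    then show False using r' pos by simp
  qed
  have le0: "gap p q r s \<le> 0" if "0 < s" for s
  proof -
    consider "s < d" | "min d s0 \<le> s" "s \<le> max S s0" | "max S s0 < s" by linarith
    then show ?thesis
    proof cases
      case 1
      \<comment> \<open>Near zero the bound is known for \<open>R\<close> and passes to
        \<open>r\<close> by monotonicity in the parameter.\<close>
      have "gap p q r s \<le> gap p q R s"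
      proof (cases "r = R")
        case False
        then show ?thesis
          using tr r R R1 pq \<open>0 < s\<close> phi_pos[of R "exp (- s)"]
          by (intro less_imp_le log_gap_strict_mono) auto
      qed simp
      also have "\<dots> < 0" using d(2)[OF that 1] .
      finally show ?thesis by simp
    next
      case 3
      have "gap p q r s < gap p q r (max S s0)"
        using gap_decreasing[OF _ _ pq 3] S(2) tr r by auto
      also have "\<dots> \<le> 0" by (rule in_range) auto
      finally show ?thesis by simp
    qed (rule in_range)
  qed
  obtain K where K: "0 < K" "(gap p q r has_real_derivative
     K * (exp (- ((p - 1) * t)) - exp (- el q r t))) (at t)"
    using gap_has_deriv[of r p q] r pq by (metis less_imp_le)
  \<comment> \<open>With radius \<open>t\<close> the neighbourhood of \<open>t\<close> contains only
    positive arguments, where \<open>gap\<close> is at most zero, its value at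
    \<open>t\<close>.\<close>
  have "K * (exp (- ((p - 1) * t)) - exp (- el q r t)) = 0"
    by (rule DERIV_local_max[OF K(2) \<open>0 < t\<close>]) (use le0 tr in \<open>auto simp: abs_if split: if_splits\<close>)
  then have "excess p q r t = 0" using K by (simp add: excess_def)
  then show ?thesis using that r \<open>0 < t\<close> tr by blast
qed

section \<open>Reduction to two-valued functions\<close>

text \<open>The logarithm of the norm ratio for a nonzero function with nonnegative values
  \<open>a, b, c\<close>. As \<open>m\<close> is \<open>1 - r\<close> times the mean, the image
  takes the values \<open>r * a + m\<close>, \<open>r * b + m\<close>,
  \<open>r * c + m\<close>.\<close>

definition triple_gap :: "real \<Rightarrow> real \<Rightarrow> real \<Rightarrow> real \<Rightarrow> real \<Rightarrow> real \<Rightarrow> real" where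
  "triple_gap p q r a b c = (let m = (1 - r) * ((a + b + c) / 3) in
     ln (((r * a + m) powr q + (r * b + m) powr q + (r * c + m) powr q) / 3) / q
     - ln ((a powr p + b powr p + c powr p) / 3) / p)"

definition triple_gap_deriv :: "real \<Rightarrow> real \<Rightarrow> real \<Rightarrow> real \<Rightarrow> real \<Rightarrow> real \<Rightarrow> real" where
  "triple_gap_deriv p q r a b c = (let m = (1 - r) * ((a + b + c) / 3) in
     (r * (r * a + m) powr (q - 1)
       + (1 - r) / 3 * ((r * a + m) powr (q - 1) + (r * b + m) powr (q - 1) + (r * c + m) powr (q - 1)))
     / ((r * a + m) powr q + (r * b + m) powr q + (r * c + m) powr q)
     - a powr (p - 1) / (a powr p + b powr p + c powr p))"

lemma triple_pos:
  fixes a b c :: real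
  assumes "0 < r" "r < 1" "0 \<le> a" "0 \<le> b" "0 \<le> c" "0 < a + b + c"
  shows "0 < (1 - r) * ((a + b + c) / 3)"
    "0 < r * a + (1 - r) * ((a + b + c) / 3)" "0 < r * b + (1 - r) * ((a + b + c) / 3)"
    "0 < r * c + (1 - r) * ((a + b + c) / 3)" "0 < a powr p + b powr p + c powr p"
proof -
  show *: "0 < (1 - r) * ((a + b + c) / 3)" using assms by simp
  show "0 < r * a + (1 - r) * ((a + b + c) / 3)" "0 < r * b + (1 - r) * ((a + b + c) / 3)"
    "0 < r * c + (1 - r) * ((a + b + c) / 3)"
    using assms by (intro add_nonneg_pos[OF _ *]; simp)+
  have "a \<noteq> 0 \<or> b \<noteq> 0 \<or> c \<noteq> 0" using assms by auto
  then have "a powr p \<noteq> 0 \<or> b powr p \<noteq> 0 \<or> c powr p \<noteq> 0" by simp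
  moreover have "0 \<le> a powr p" "0 \<le> b powr p" "0 \<le> c powr p" by simp_all
  ultimately show "0 < a powr p + b powr p + c powr p" by linarith
qed

lemma triple_gap_has_deriv:
  assumes "0 < r" "r < 1" "1 < p" "1 < q" "0 < a" "0 \<le> b" "0 \<le> c"
  shows "((\<lambda>t. triple_gap p q r t b c) has_real_derivative triple_gap_deriv p q r a b c) (at a)"
proof -
  define m where "m = (\<lambda>t. (1 - r) * ((t + b + c) / 3))"
  have pos: "0 < r * a + m a" "0 < r * b + m a" "0 < r * c + m a" "0 < a powr p + b powr p + c powr p"
    using triple_pos[of r a b c] assms by (auto simp: m_def)
  have m: "(m has_real_derivative (1 - r) / 3) (at a)"
    unfolding m_def by (auto intro!: derivative_eq_intros)
  have "((\<lambda>t. r * t + m t) has_real_derivative r + (1 - r) / 3) (at a)"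
    "((\<lambda>t. r * b + m t) has_real_derivative (1 - r) / 3) (at a)"
    "((\<lambda>t. r * c + m t) has_real_derivative (1 - r) / 3) (at a)"
    by (auto intro!: derivative_eq_intros m)
  note dw = this[THEN DERIV_fun_powr, of q]
  let ?W = "\<lambda>t. (r * t + m t) powr q + (r * b + m t) powr q + (r * c + m t) powr q"
  let ?V = "(r * a + m a) powr (q - 1) + (r * b + m a) powr (q - 1) + (r * c + m a) powr (q - 1)"
  have "(?W has_real_derivative q * (r * (r * a + m a) powr (q - 1) + (1 - r) / 3 * ?V)) (at a)"
    by (rule DERIV_cong[OF DERIV_add[OF DERIV_add[OF dw(1) dw(2)] dw(3)]])
      (use pos in \<open>simp_all add: field_simps\<close>)
  moreover have "0 < ?W a" using pos by (intro add_pos_pos) auto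
  ultimately have dW: "((\<lambda>t. ln (?W t / 3) / q) has_real_derivative
      q * (r * (r * a + m a) powr (q - 1) + (1 - r) / 3 * ?V) / ?W a / q) (at a)"
    by (rule DERIV_ln_third_divide)
  have "((\<lambda>t. t powr p + b powr p + c powr p) has_real_derivative p * a powr (p - 1)) (at a)"
    using DERIV_fun_powr[OF DERIV_ident, of a p] assms
    by (auto intro!: derivative_eq_intros)
  from DERIV_ln_third_divide[OF this pos(4)]
  have dP: "((\<lambda>t. ln ((t powr p + b powr p + c powr p) / 3) / p) has_real_derivative
      p * a powr (p - 1) / (a powr p + b powr p + c powr p) / p) (at a)" .
  have cancel: "k * u / v / k = u / v" if "1 < k" for k u v :: real using that by simp
  show ?thesis
    using DERIV_diff[OF dW dP] unfolding cancel[OF assms(3)] cancel[OF assms(4)]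
    by (simp add: triple_gap_def[abs_def] triple_gap_deriv_def Let_def m_def)
qed

lemma continuous_on_triple_gap:
  fixes f g h :: "'a::topological_space \<Rightarrow> real"
  assumes "0 < r" "r < 1" "1 < p" "1 < q"
    and "continuous_on A f" "continuous_on A g" "continuous_on A h"
    and nn: "\<And>z. z \<in> A \<Longrightarrow> 0 \<le> f z \<and> 0 \<le> g z \<and> 0 \<le> h z \<and> 0 < f z + g z + h z"
  shows "continuous_on A (\<lambda>z. triple_gap p q r (f z) (g z) (h z))"
    and "continuous_on A (\<lambda>z. triple_gap_deriv p q r (f z) (g z) (h z))"
proof -
  have pos: "0 < r * f z + (1 - r) * ((f z + g z + h z) / 3)"
    "0 < r * g z + (1 - r) * ((f z + g z + h z) / 3)"
    "0 < r * h z + (1 - r) * ((f z + g z + h z) / 3)"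
    "0 < f z powr p + g z powr p + h z powr p" if "z \<in> A" for z
    using triple_pos[of r "f z" "g z" "h z"] nn[OF that] assms by auto
  have W: "0 < (r * f z + (1 - r) * ((f z + g z + h z) / 3)) powr q
    + (r * g z + (1 - r) * ((f z + g z + h z) / 3)) powr q
    + (r * h z + (1 - r) * ((f z + g z + h z) / 3)) powr q" if "z \<in> A" for z
    using pos[OF that] by (intro add_pos_pos) auto
  note c = continuous_on_add continuous_on_diff continuous_on_mult continuous_on_divide
    continuous_on_ln continuous_on_powr' continuous_on_const assms(5-7)
  show "continuous_on A (\<lambda>z. triple_gap p q r (f z) (g z) (h z))"
    unfolding triple_gap_def Let_def
    by (intro c ballI; use pos W nn assms in \<open>force simp: less_imp_le\<close>)
  show "continuous_on A (\<lambda>z. triple_gap_deriv p q r (f z) (g z) (h z))"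
    unfolding triple_gap_deriv_def Let_def
    by (intro c ballI; use pos W nn assms in \<open>force simp: less_imp_le\<close>)
qed

text \<open>A maximum on the face \<open>a = 0\<close> is impossible: there the term with
  \<open>a powr (p - 1)\<close> vanishes, whereas averaging with \<open>r < 1\<close> keeps the
  other term positive.\<close>

lemma triple_gap_max_coordinate:
  assumes r: "0 < r" "r < 1" and pq: "1 < p" "1 < q" and nn: "0 \<le> a" "0 \<le> b" "0 \<le> c"
    and bc: "0 < b + c"
    and max: "\<And>t. 0 \<le> t \<Longrightarrow> triple_gap p q r t b c \<le> triple_gap p q r a b c"
  shows "0 < a" "triple_gap_deriv p q r a b c = 0"
proof -
  show "0 < a"
  proof (rule ccontr)
    assume "\<not> 0 < a"
    then have "a = 0" using nn by simp
    define m where "m = (1 - r) * ((0 + b + c) / 3)"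
    note pos = triple_pos[OF r order_refl nn(2,3), folded m_def]
    have "0 < triple_gap_deriv p q r 0 b c"
      unfolding triple_gap_deriv_def Let_def m_def[symmetric]
      using pos bc r pq by (auto intro!: divide_pos_pos mult_pos_pos add_pos_pos add_nonneg_pos)
    \<comment> \<open>The derivative formula is available only for positive arguments, so its sign
      at \<open>0\<close> is carried to the right by continuity.\<close>
    moreover have "continuous_on {0..1} (\<lambda>t. triple_gap_deriv p q r t b c)"
      using nn bc by (intro continuous_on_triple_gap r pq) auto
    ultimately have "\<forall>\<^sub>F t in at_right 0. 0 < triple_gap_deriv p q r t b c"
      using continuous_on_Icc_at_rightD[of 0 1] order_tendstoD(1) by fastforce
    then obtain e where e: "0 < e" "\<And>t. 0 < t \<Longrightarrow> t < e \<Longrightarrow> 0 < triple_gap_deriv p q r t b c"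
      by (auto simp: eventually_at_right_field)
    have "triple_gap p q r 0 b c < triple_gap p q r e b c"
    proof (rule DERIV_pos_imp_increasing_open[OF e(1)])
      fix t assume "0 < t" "t < e"
      then show "\<exists>y. ((\<lambda>t. triple_gap p q r t b c) has_real_derivative y) (at t) \<and> 0 < y"
        using triple_gap_has_deriv[OF r pq _ nn(2,3)] e(2) by blast
    next
      show "continuous_on {0..e} (\<lambda>t. triple_gap p q r t b c)"
        using nn bc by (intro continuous_on_triple_gap r pq) auto
    qed
    then show False using max[of e] e(1) \<open>a = 0\<close> by simp
  qed
  then show "triple_gap_deriv p q r a b c = 0"
    by (intro DERIV_local_max[OF triple_gap_has_deriv[OF r pq _ nn(2,3)] \<open>0 < a\<close>])
      (auto intro!: max simp: abs_if split: if_splits)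
qed

text \<open>Up to a positive constant the expression is the derivative of
  \<open>(A * s powr \<alpha> + B) powr \<beta>\<close>, so this is strict convexity of that
  function.\<close>

lemma powr_of_affine_powr_strict_mono:
  fixes \<alpha> \<beta> :: real
  assumes "1 \<le> \<alpha>" "1 < \<alpha> * \<beta>" "0 < A" "0 < B" "0 < s" "s < t"
  shows "s powr (\<alpha> - 1) * (A * s powr \<alpha> + B) powr (\<beta> - 1)
    < t powr (\<alpha> - 1) * (A * t powr \<alpha> + B) powr (\<beta> - 1)"
proof -
  have pos: "0 < A * z powr \<alpha> + B" for z using assms by (intro add_nonneg_pos) auto
  have "0 < \<beta>" using assms by (smt (verit) mult_nonneg_nonpos)
  show ?thesis
  proof (cases "1 \<le> \<beta>")
    case True
    have st: "s powr \<alpha> < t powr \<alpha>" using assms by (intro powr_less_mono2) auto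
    show ?thesis
    proof (cases "\<beta> = 1")
      case True
      then have "s powr (\<alpha> - 1) < t powr (\<alpha> - 1)" using assms by (intro powr_less_mono2) auto
      then show ?thesis using True pos[of s] pos[of t] by simp
    next
      case False
      have "(A * s powr \<alpha> + B) powr (\<beta> - 1) < (A * t powr \<alpha> + B) powr (\<beta> - 1)"
        using st False True assms pos[of s] by (intro powr_less_mono2) auto
      moreover have "s powr (\<alpha> - 1) \<le> t powr (\<alpha> - 1)" using assms by (intro powr_mono2) auto
      ultimately show ?thesis using assms by (intro mult_le_less_imp_less) auto
    qed
  next
    case False
    \<comment> \<open>The exponent \<open>\<beta> - 1\<close> is negative here. Moving a power of
      \<open>z\<close> out of the bracket leaves an increasing power with exponent
      \<open>\<alpha> * \<beta> - 1\<close> and a bracket that decreases in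
      \<open>z\<close>.\<close>
    have eq: "z powr (\<alpha> - 1) * (A * z powr \<alpha> + B) powr (\<beta> - 1)
        = z powr (\<alpha> * \<beta> - 1) * (A + B * z powr - \<alpha>) powr (\<beta> - 1)" if "0 < z" for z
    proof -
      have "A * z powr \<alpha> + B = z powr \<alpha> * (A + B * z powr - \<alpha>)"
        using that by (simp add: powr_minus field_simps)
      moreover have "0 \<le> A + B * z powr - \<alpha>" using assms by (intro add_nonneg_nonneg) auto
      moreover have "z powr (\<alpha> - 1) * (z powr \<alpha>) powr (\<beta> - 1) = z powr (\<alpha> * \<beta> - 1)"
        using that by (simp add: powr_powr powr_add[symmetric] algebra_simps)
      ultimately show ?thesis using that by (simp add: powr_mult mult.assoc[symmetric])
    qed
    have "t powr - \<alpha> \<le> s powr - \<alpha>" using assms by (intro powr_mono2') auto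
    then have "A + B * t powr - \<alpha> \<le> A + B * s powr - \<alpha>" using assms by simp
    then have "(A + B * s powr - \<alpha>) powr (\<beta> - 1) \<le> (A + B * t powr - \<alpha>) powr (\<beta> - 1)"
      using False assms by (intro powr_mono2') (auto intro: add_pos_nonneg)
    moreover have "s powr (\<alpha> * \<beta> - 1) < t powr (\<alpha> * \<beta> - 1)"
      using assms by (intro powr_less_mono2) auto
    moreover have "0 < A + B * s powr - \<alpha>" using assms by (intro add_pos_nonneg) auto
    ultimately show ?thesis
      unfolding eq[OF assms(5)] eq[OF order.strict_trans[OF assms(5,6)]]
      by (intro mult_less_le_imp_less) auto
  qed
qed

text \<open>By Rolle, three zeros of the difference to a line would give two zeros of its
  derivative, which is strictly increasing.\<close>

lemma powr_of_affine_powr_no_three_collinear: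
  fixes \<alpha> \<beta> :: real
  assumes "1 \<le> \<alpha>" "1 < \<alpha> * \<beta>" "0 < A" "0 < B"
    and pos: "0 < x" "0 < y" "0 < z"
    and on_line: "\<And>s. s \<in> {x, y, z} \<Longrightarrow> (A * s powr \<alpha> + B) powr \<beta> = u * s + v"
  shows "x = y \<or> x = z \<or> y = z"
proof (rule ccontr)
  define k where "k = (\<lambda>s. (A * s powr \<alpha> + B) powr \<beta> - (u * s + v))"
  define k' where "k' = (\<lambda>s. \<alpha> * \<beta> * A * (s powr (\<alpha> - 1) * (A * s powr \<alpha> + B) powr (\<beta> - 1)) - u)"
  have d: "(k has_real_derivative k' s) (at s)" if "0 < s" for s
  proof -
    have "0 < A * s powr \<alpha> + B" using assms by (intro add_nonneg_pos) auto
    moreover have "((\<lambda>s. A * s powr \<alpha> + B) has_real_derivative A * (\<alpha> * s powr (\<alpha> - 1))) (at s)"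
      using DERIV_fun_powr[OF DERIV_ident, of s \<alpha>] that by (auto intro!: derivative_eq_intros)
    ultimately have "((\<lambda>s. (A * s powr \<alpha> + B) powr \<beta>) has_real_derivative
        \<beta> * (A * s powr \<alpha> + B) powr (\<beta> - 1) * (A * (\<alpha> * s powr (\<alpha> - 1)))) (at s)"
      using DERIV_fun_powr by fastforce
    moreover have "((\<lambda>s. u * s + v) has_real_derivative u) (at s)"
      by (auto intro!: derivative_eq_intros)
    ultimately show ?thesis
      unfolding k_def k'_def by (intro DERIV_cong[OF DERIV_diff]) (auto simp: mult_ac)
  qed
  have sorted: False if s: "0 < s1" "s1 < s2" "s2 < s3" "k s1 = 0" "k s2 = 0" "k s3 = 0" for s1 s2 s3
  proof -
    obtain a where a: "s1 < a" "a < s2" "k s2 - k s1 = (s2 - s1) * k' a"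
      using MVT2[OF s(2), of k k'] d s by force
    obtain b where b: "s2 < b" "b < s3" "k s3 - k s2 = (s3 - s2) * k' b"
      using MVT2[OF s(3), of k k'] d s by force
    have "k' a = 0" "k' b = 0" using a b s by auto
    moreover have "a < b" "0 < a" using a b s by auto
    moreover have "0 < \<alpha> * \<beta> * A" using assms by (intro mult_pos_pos[of "\<alpha> * \<beta>"]) auto
    ultimately show False
      using powr_of_affine_powr_strict_mono[OF assms(1-4) \<open>0 < a\<close> \<open>a < b\<close>]
        mult_strict_left_mono[of _ _ "\<alpha> * \<beta> * A"] unfolding k'_def by fastforce
  qed
  assume "\<not> (x = y \<or> x = z \<or> y = z)"
  moreover have "k x = 0" "k y = 0" "k z = 0" using on_line by (auto simp: k_def)
  ultimately show False using sorted pos by (metis linorder_neqE_linordered_idom)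
qed

text \<open>The three coordinates of a critical point solve one equation in one unknown. It equates
  a power of an affine function of a power to an affine function, in the unknown \<open>a powr (p - 1)\<close>
  for \<open>p \<le> 2\<close> and in the unknown \<open>r * a + m\<close> for \<open>2 < p\<close>; this choice makes the former
  strictly convex.\<close>

lemma critical_triple_two_equal:
  fixes p q r m a b c :: real
  assumes pq: "1 < p" "p < q" and "0 < r" "0 < m" "0 < M" "0 < W" "0 < P"
    and pos: "0 < a" "0 < b" "0 < c"
    and eq: "\<And>t. t \<in> {a, b, c} \<Longrightarrow> t powr (p - 1) / P = r * (r * t + m) powr (q - 1) / W + M"
  shows "a = b \<or> a = c \<or> b = c"
proof (cases "p \<le> 2")
  case True
  define h where "h = (\<lambda>t. t powr (p - 1))"
  have inv: "h t powr (1 / (p - 1)) = t" if "0 < t" for t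
    using that pq powr_powr[of t "p - 1" "1 / (p - 1)"] by (simp add: h_def)
  have "h a = h b \<or> h a = h c \<or> h b = h c"
  \<comment> \<open>Here \<alpha> is \<open>1 / (p - 1)\<close> and \<beta> is \<open>q - 1\<close>,
    so the conditions on the exponents amount to \<open>p \<le> 2\<close> and
    \<open>p < q\<close>.\<close>
  proof (rule powr_of_affine_powr_no_three_collinear)
    fix s assume "s \<in> {h a, h b, h c}"
    then obtain t where t: "s = h t" "t \<in> {a, b, c}" by auto
    then have "0 < t" using pos by auto
    have "(r * h t powr (1 / (p - 1)) + m) powr (q - 1) = (r * t + m) powr (q - 1)"
      using inv[OF \<open>0 < t\<close>] by simp
    also have "\<dots> = (W / (r * P)) * h t + - (M * W / r)"
      using eq[OF t(2)] assms(3,6,7) unfolding h_def by (simp add: field_simps)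
    finally show "(r * s powr (1 / (p - 1)) + m) powr (q - 1) = (W / (r * P)) * s + - (M * W / r)"
      using t by simp
  qed (use assms True in \<open>auto simp: h_def field_simps\<close>)
  then show ?thesis using inv pos by metis
next
  case False
  define w where "w = (\<lambda>t. r * t + m)"
  have "w a = w b \<or> w a = w c \<or> w b = w c"
  \<comment> \<open>Now \<alpha> is \<open>q - 1\<close> and \<beta> is \<open>1 / (p - 1)\<close>;
    \<open>2 < p < q\<close> makes \<alpha> at least one.\<close>
  proof (rule powr_of_affine_powr_no_three_collinear)
    fix s assume "s \<in> {w a, w b, w c}"
    then obtain t where t: "s = w t" "t \<in> {a, b, c}" by auto
    then have "0 < t" using pos by auto
    have "(P * r / W) * w t powr (q - 1) + P * M = t powr (p - 1)"
      using eq[OF t(2)] assms(3,6,7) unfolding w_def by (simp add: field_simps)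
    then have "((P * r / W) * w t powr (q - 1) + P * M) powr (1 / (p - 1)) = t"
      using \<open>0 < t\<close> pq by (simp add: powr_powr)
    also have "t = (1 / r) * w t + - (m / r)"
      using assms(3) by (simp add: w_def field_simps)
    finally show "((P * r / W) * s powr (q - 1) + P * M) powr (1 / (p - 1)) = (1 / r) * s + - (m / r)"
      using t by simp
  qed (use assms False in \<open>auto simp: w_def field_simps add_pos_pos\<close>)
  then show ?thesis using assms(3) by (auto simp: w_def)
qed

section \<open>Passage from triples to the curve by maximization\<close>

lemma triple_gap_commute:
  "triple_gap p q r a b c = triple_gap p q r b a c"
  "triple_gap p q r a b c = triple_gap p q r c b a"
  by (simp_all add: triple_gap_def Let_def add_ac)

lemma triple_gap_scale:
  assumes r: "0 < r" "r < 1" and pq: "1 < p" "1 < q"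
    and nn: "0 \<le> a" "0 \<le> b" "0 \<le> c" "0 < a + b + c" and "0 < k"
  shows "triple_gap p q r (k * a) (k * b) (k * c) = triple_gap p q r a b c"
proof -
  define m where "m = (1 - r) * ((a + b + c) / 3)"
  note pos = triple_pos[OF r nn, folded m_def]
  define W P where "W = (r * a + m) powr q + (r * b + m) powr q + (r * c + m) powr q"
    and "P = a powr p + b powr p + c powr p"
  have WP: "0 < W" "0 < P" using pos by (auto simp: W_def P_def add_pos_pos)
  have m: "(1 - r) * ((k * a + k * b + k * c) / 3) = k * m" by (simp add: m_def algebra_simps)
  have sc: "(r * (k * t) + k * m) powr q = k powr q * (r * t + m) powr q" if "0 < r * t + m" for t
  proof -
    have "r * (k * t) + k * m = k * (r * t + m)" by (simp add: algebra_simps)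
    then show ?thesis using that \<open>0 < k\<close> by (simp add: powr_mult)
  qed
  have ln: "ln (k powr e * (w / 3)) = e * ln k + ln (w / 3)" if "0 < w" for e w
    using that \<open>0 < k\<close> ln_mult[of "k powr e" "w / 3"] by (simp add: ln_powr)
  have "triple_gap p q r (k * a) (k * b) (k * c)
      = ln (k powr q * (W / 3)) / q - ln (k powr p * (P / 3)) / p"
    unfolding triple_gap_def Let_def m sc[OF pos(2)] sc[OF pos(3)] sc[OF pos(4)] W_def P_def
    using nn \<open>0 < k\<close> by (simp add: powr_mult distrib_left)
  also have "\<dots> = ln (W / 3) / q - ln (P / 3) / p"
    unfolding ln[OF WP(1)] ln[OF WP(2)] using pq by (simp add: add_divide_distrib)
  also have "\<dots> = triple_gap p q r a b c"
    by (simp add: triple_gap_def Let_def W_def P_def m_def)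
  finally show ?thesis .
qed

lemma triple_gap_two_equal:
  assumes r: "0 < r" "r < 1" and pq: "1 < p" "1 < q" and "0 < a" "0 < b"
  shows "triple_gap p q r a b b = log_gap p q r (b / a)"
proof -
  define x where "x = b / a"
  have "triple_gap p q r a b b = triple_gap p q r (a * 1) (a * x) (a * x)"
    using assms by (simp add: x_def)
  also have "\<dots> = triple_gap p q r 1 x x"
    using assms by (intro triple_gap_scale) (auto simp: x_def add_pos_pos)
  also have "\<dots> = log_gap p q r x"
  proof -
    have e: "r * 1 + (1 - r) * ((1 + x + x) / 3) = (1 + 2 * r + 2 * (1 - r) * x) / 3"
      "r * x + (1 - r) * ((1 + x + x) / 3) = (1 - r + (2 + r) * x) / 3"
      by (simp_all add: field_simps)
    show ?thesis
      unfolding triple_gap_def Let_def log_gap_def e by (simp only: mult_2 add.assoc powr_one_eq_one)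
  qed
  finally show ?thesis by (simp add: x_def)
qed

text \<open>By homogeneity the supremum is attained on the compact simplex of triples with sum one.
  A maximizer has positive coordinates solving one scalar equation, so two of them coincide, and up
  to order and scale it lies on the curve, where \<open>le\<close> applies.\<close>

lemma triple_gap_nonpos:
  assumes r: "0 < r" "r < 1" and pq: "1 < p" "p < q"
    and le: "\<And>x. 0 < x \<Longrightarrow> log_gap p q r x \<le> 0"
    and nn: "0 \<le> a0" "0 \<le> b0" "0 \<le> c0" "0 < a0 + b0 + c0"
  shows "triple_gap p q r a0 b0 c0 \<le> 0"
proof -
  have "1 < q" using pq by simp
  note scale = triple_gap_scale[OF r pq(1) \<open>1 < q\<close>]
  define D where "D = {(a, b, c). 0 \<le> a \<and> 0 \<le> b \<and> 0 \<le> c \<and> a + b + c = (1::real)}"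
  define G where "G = (\<lambda>z. triple_gap p q r (fst z) (fst (snd z)) (snd (snd z)))"
  have D_eq: "D = ({0..1} \<times> {0..1} \<times> {0..1}) \<inter> {z. fst z + fst (snd z) + snd (snd z) = 1}"
    by (auto simp: D_def)
  have "compact D"
    unfolding D_eq
    by (intro compact_Int_closed compact_Times compact_Icc closed_Collect_eq continuous_intros)
  moreover have "(1, 0, 0) \<in> D" by (simp add: D_def)
  moreover have "continuous_on D G"
    unfolding G_def using pq
    by (intro continuous_on_triple_gap r continuous_intros) (auto simp: D_def)
  ultimately obtain z where z: "z \<in> D" "\<And>z'. z' \<in> D \<Longrightarrow> G z' \<le> G z"
    using continuous_attains_sup[of D G] by blast
  obtain a b c where abc: "z = (a, b, c)" by (cases z)
  have nn1: "0 \<le> a" "0 \<le> b" "0 \<le> c" "a + b + c = 1" using z(1) abc by (auto simp: D_def)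
  have max: "triple_gap p q r a' b' c' \<le> triple_gap p q r a b c"
    if "0 \<le> a'" "0 \<le> b'" "0 \<le> c'" "0 < a' + b' + c'" for a' b' c'
  proof -
    let ?k = "1 / (a' + b' + c')"
    have "(?k * a', ?k * b', ?k * c') \<in> D"
      using that by (auto simp: D_def add_divide_distrib[symmetric])
    from z(2)[OF this] have "triple_gap p q r (?k * a') (?k * b') (?k * c') \<le> triple_gap p q r a b c"
      by (simp add: G_def abc)
    then show ?thesis using scale[OF that, of ?k] that by simp
  qed
  note crit = triple_gap_max_coordinate[OF r pq(1) \<open>1 < q\<close>]
  have A: "0 < a \<and> triple_gap_deriv p q r a b c = 0" if "0 < b + c"
    using crit[OF nn1(1,2,3) that] max nn1 that by auto
  have B: "0 < b \<and> triple_gap_deriv p q r b a c = 0" if "0 < a + c"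
    using crit[OF nn1(2,1,3) that] max nn1 that triple_gap_commute(1)[of p q r _ a c] by auto
  have C: "0 < c \<and> triple_gap_deriv p q r c b a = 0" if "0 < b + a"
    using crit[OF nn1(3,2,1) that] max nn1 that triple_gap_commute(2)[of p q r _ b a] by auto
  \<comment> \<open>Some coordinate is positive because the sum is one; it makes the other two
    positive.\<close>
  have pos: "0 < a" "0 < b" "0 < c" using A B C nn1 by linarith+
  define m where "m = (1 - r) * ((a + b + c) / 3)"
  define W V P where "W = (r * a + m) powr q + (r * b + m) powr q + (r * c + m) powr q"
    and "V = (r * a + m) powr (q - 1) + (r * b + m) powr (q - 1) + (r * c + m) powr (q - 1)"
    and "P = a powr p + b powr p + c powr p"
  have m: "0 < m" using r nn1 by (simp add: m_def)
  then have w: "0 < r * a + m" "0 < r * b + m" "0 < r * c + m" using r pos by (auto simp: add_pos_pos)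
  then have WVP: "0 < W" "0 < V" "0 < P" using pos by (auto simp: W_def V_def P_def add_pos_pos)
  \<comment> \<open>\<open>W\<close>, \<open>V\<close> and \<open>P\<close> are symmetric in the
    coordinates, so the three vanishing derivatives are instances of one equation.\<close>
  have "t powr (p - 1) / P = r * (r * t + m) powr (q - 1) / W + (1 - r) / 3 * V / W"
    if "t \<in> {a, b, c}" for t
  proof -
    have "triple_gap_deriv p q r a b c = 0" "triple_gap_deriv p q r b a c = 0"
      "triple_gap_deriv p q r c b a = 0" using A B C pos by auto
    then show ?thesis
      using that unfolding triple_gap_deriv_def Let_def
      by (auto simp: W_def V_def P_def m_def add_ac add_divide_distrib)
  qed
  moreover have "0 < (1 - r) / 3 * V / W" using r WVP by simp
  ultimately have "a = b \<or> a = c \<or> b = c"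
    using critical_triple_two_equal[OF pq r(1) m _ WVP(1,3) pos] by blast
  moreover have "triple_gap p q r s t t \<le> 0" if "0 < s" "0 < t" for s t
    using triple_gap_two_equal[OF r pq(1) \<open>1 < q\<close> that] le[of "t / s"] that by simp
  ultimately have "triple_gap p q r a b c \<le> 0"
    using pos triple_gap_commute[of p q r] by metis
  then show ?thesis using max[OF nn] by simp
qed

section \<open>The hypercontractive constant\<close>

lemma T_op_apply: "T_op r f k = of_real r * f k + of_real (1 - r) * ((\<Sum>k\<in>UNIV. f k) / 3)"
  using exhaust_Z3[of k] unfolding T_op_def Let_def trig_poly_def sum_Z3
  by (elim disjE) (simp_all add: chi_values complex_eq_iff field_simps)

text \<open>As \<open>r\<close> and \<open>1 - r\<close> are positive, replacing \<open>f\<close> by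
  its absolute value keeps \<open>Lp_norm p f\<close> and can only raise the norm of the
  image.\<close>

lemma hypercontractive_at:
  assumes r: "0 < r" "r < 1" and pq: "1 < p" "p < q"
    and le: "\<And>x. 0 < x \<Longrightarrow> log_gap p q r x \<le> 0"
  shows "Lp_norm q (T_op r f) \<le> Lp_norm p f"
proof -
  define a b c where "a = cmod (f 0)" and "b = cmod (f 1)" and "c = cmod (f 2)"
  define m where "m = (1 - r) * ((a + b + c) / 3)"
  have nn: "0 \<le> a" "0 \<le> b" "0 \<le> c" by (auto simp: a_def b_def c_def)
  define W P where "W = (r * a + m) powr q + (r * b + m) powr q + (r * c + m) powr q"
    and "P = a powr p + b powr p + c powr p"
  have P: "Lp_norm p f = (P / 3) powr (1 / p)"
    by (simp add: Lp_norm_def sum_Z3 P_def a_def b_def c_def)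
  have T: "cmod (T_op r f k) \<le> r * cmod (f k) + m" for k
  proof -
    have "cmod (T_op r f k) \<le> cmod (of_real r * f k) + cmod (of_real (1 - r) * ((\<Sum>k\<in>UNIV. f k) / 3))"
      unfolding T_op_apply by (rule norm_triangle_ineq)
    also have "\<dots> = r * cmod (f k) + (1 - r) * (cmod (f 0 + f 1 + f 2) / 3)"
      using r by (simp add: norm_mult norm_divide sum_Z3 del: of_real_diff)
    also have "\<dots> \<le> r * cmod (f k) + m"
    proof -
      have "cmod (f 0 + f 1 + f 2) \<le> a + b + c"
        unfolding a_def b_def c_def by (intro norm_triangle_mono norm_triangle_ineq order_refl)
      then show ?thesis unfolding m_def using r by (intro add_left_mono mult_left_mono divide_right_mono) auto
    qed
    finally show ?thesis .
  qed
  have W: "Lp_norm q (T_op r f) \<le> (W / 3) powr (1 / q)"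
    unfolding Lp_norm_def sum_Z3 W_def a_def b_def c_def
    using pq T by (intro powr_mono2 divide_right_mono add_mono) auto
  show ?thesis
  \<comment> \<open>The zero function is treated apart because the logarithms need positive
    norms.\<close>
  proof (cases "a + b + c = 0")
    case True
    then have "a = 0" "b = 0" "c = 0" "m = 0" using nn by (auto simp: m_def)
    then have "W = 0" using pq by (simp add: W_def)
    then have "Lp_norm q (T_op r f) \<le> 0" using W pq by simp
    also have "0 \<le> Lp_norm p f" by (simp add: Lp_norm_def)
    finally show ?thesis .
  next
    case False
    then have "0 < a + b + c" using nn by linarith
    note pos = triple_pos[OF r nn this, folded m_def]
    have WP: "0 < W" "0 < P" using pos by (auto simp: W_def P_def add_pos_pos)
    have "triple_gap p q r a b c \<le> 0"
      using triple_gap_nonpos[OF r pq le nn \<open>0 < a + b + c\<close>] .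
    then have "ln (W / 3) / q \<le> ln (P / 3) / p"
      by (simp add: triple_gap_def Let_def W_def P_def m_def)
    then have "(W / 3) powr (1 / q) \<le> (P / 3) powr (1 / p)"
      using WP by (simp add: powr_def)
    with W P show ?thesis by simp
  qed
qed

section \<open>Norms of two-valued functions and the optimal constant\<close>

lemma Lp_norm_two_valued:
  assumes "f 0 = of_real (s * u)" "f 1 = of_real (s * v)" "f 2 = of_real (s * v)"
    and "0 < s" "0 < u" "0 < v" "1 < p"
  shows "Lp_norm p f = s * ((u powr p + 2 * v powr p) / 3) powr (1 / p)"
proof -
  have "Lp_norm p f = (s powr p * ((u powr p + 2 * v powr p) / 3)) powr (1 / p)"
    using assms by (simp add: Lp_norm_def sum_Z3 powr_mult norm_mult algebra_simps)
  also have "\<dots> = (s powr p) powr (1 / p) * ((u powr p + 2 * v powr p) / 3) powr (1 / p)"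
    by (rule powr_mult)
  finally show ?thesis using assms by (simp add: powr_powr)
qed

lemma log_gap_eq_Lp_norms:
  assumes f: "f 0 = of_real s" "f 1 = of_real (s * x)" "f 2 = of_real (s * x)"
    and "0 < s" "0 < x" "1 < p" "1 < q" "0 \<le> r" "r \<le> 1"
  shows "log_gap p q r x = ln (Lp_norm q (T_op r f) / Lp_norm p f)"
    "0 < Lp_norm q (T_op r f)" "0 < Lp_norm p f"
proof -
  define B S where "B = (1 + 2 * r + 2 * (1 - r) * x) / 3" and "S = (1 - r + (2 + r) * x) / 3"
  have pos: "0 < B" "0 < S" using phi_pos[of r x] assms by (auto simp: B_def S_def)
  have "T_op r f 0 = of_real (s * B)" "T_op r f 1 = of_real (s * S)" "T_op r f 2 = of_real (s * S)"
    unfolding T_op_apply sum_Z3 f B_def S_def by (simp_all add: complex_eq_iff field_simps)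
  then have q: "Lp_norm q (T_op r f) = s * ((B powr q + 2 * S powr q) / 3) powr (1 / q)"
    using pos assms by (intro Lp_norm_two_valued) auto
  have p: "Lp_norm p f = s * ((1 powr p + 2 * x powr p) / 3) powr (1 / p)"
    using assms by (intro Lp_norm_two_valued) auto
  have WP: "0 < B powr q + 2 * S powr q" "0 < 1 + 2 * x powr p"
    using pos by (auto intro: add_pos_pos add_pos_nonneg)
  then show "0 < Lp_norm q (T_op r f)" "0 < Lp_norm p f"
    unfolding p q using assms by simp_all
  have "Lp_norm q (T_op r f) / Lp_norm p f
      = ((B powr q + 2 * S powr q) / 3) powr (1 / q) / ((1 + 2 * x powr p) / 3) powr (1 / p)"
    unfolding p q using assms by simp
  then show "log_gap p q r x = ln (Lp_norm q (T_op r f) / Lp_norm p f)"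
    using WP by (simp add: log_gap_def ln_div ln_powr B_def S_def)
qed

text \<open>Arguments \<open>x > 1\<close> correspond to negative \<open>s\<close> and are covered
  by \<open>gap_negative\<close>; smaller parameters follow by monotonicity in the
  parameter.\<close>

lemma critical_point_contractive:
  assumes "0 < r" "r < 1" "1 < p" "p < q" "0 < t" "gap p q r t = 0" "excess p q r t = 0"
    and "0 < r'" "r' \<le> r" "0 < x"
  shows "log_gap p q r' x \<le> 0"
proof (cases "x = 1")
  case False
  have "gap p q r (- ln x) \<le> 0"
    using gap_negative[of r p q t "- ln x"] assms False by (cases "- ln x = t") auto
  then have "log_gap p q r x \<le> 0" using assms by simp
  moreover have "log_gap p q r' x \<le> log_gap p q r x"
    using log_gap_strict_mono[of q x r' r p] phi_pos[of r x] assms False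
    by (cases "r' = r") auto
  ultimately show ?thesis by simp
qed simp

lemma hypercontractive_const_at_critical_point:
  assumes rpq: "0 < r" "r < 1" "1 < p" "p < q"
    and t: "0 < t" "gap p q r t = 0" "excess p q r t = 0"
  shows "hypercontractive_const p q = r"
proof (rule antisym)
  have "hypercontractive_up_to p q r"
    unfolding hypercontractive_up_to_def
  proof (intro conjI allI impI)
    fix r' f assume r': "0 \<le> r' \<and> r' \<le> r"
    show "Lp_norm q (T_op r' f) \<le> Lp_norm p f"
    proof (cases "r' = 0")
      case True
      have "Lp_norm q (T_op 0 f) = cmod ((\<Sum>k\<in>UNIV. f k) / 3)"
        unfolding Lp_norm_def using assms by (simp add: T_op_apply powr_powr)
      then show ?thesis using norm_mean_le_Lp_norm[OF assms(3), of f] True by simp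
    next
      case False
      then show ?thesis
        using r' rpq critical_point_contractive[OF rpq t] by (intro hypercontractive_at) auto
    qed
  qed (use rpq in auto)
  then show "r \<le> hypercontractive_const p q"
    by (rule hypercontractive_const_greatest(2)[OF assms(3,4)])
next
  define R where "R = hypercontractive_const p q"
  have "hypercontractive_up_to p q R"
    unfolding R_def by (rule hypercontractive_const_greatest(1)[OF assms(3,4)])
  then have R: "0 \<le> R" "R \<le> 1" "\<And>f. Lp_norm q (T_op R f) \<le> Lp_norm p f"
    by (auto simp: hypercontractive_up_to_def)
  \<comment> \<open>At parameter \<open>r\<close> the function with values \<open>(1, x, x)\<close>
    has equal norms, so by strict monotonicity it violates the inequality at any larger
    parameter.\<close>
  define x where "x = exp (- t)"
  have x: "0 < x" "x < 1" using t by (auto simp: x_def)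
  define f :: "Z3 \<Rightarrow> complex" where "f k = (if k = 0 then 1 else of_real x)" for k
  have f: "f 0 = of_real 1" "f 1 = of_real (1 * x)" "f 2 = of_real (1 * x)"
    by (simp_all add: f_def)
  note gap = log_gap_eq_Lp_norms[OF f, of p q R]
  have "log_gap p q R x \<le> 0"
    using gap R x rpq by (simp add: ln_le_zero_iff)
  moreover have "log_gap p q r x < log_gap p q R x" if "r < R"
    using log_gap_strict_mono[of q x r R p] phi_pos[of R x] R x rpq that by auto
  ultimately show "R \<le> r" using t(2) by (force simp: x_def)
qed

text \<open>Both parameters equal the hypercontractive constant, and for a common parameter
  \<open>gap\<close> is negative at every other nonzero argument.\<close>

lemma critical_point_unique:
  assumes pq: "1 < p" "p < q"
    and c1: "0 < r" "r < 1" "0 < t" "gap p q r t = 0" "excess p q r t = 0"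
    and c2: "0 < r'" "r' < 1" "0 < t'" "gap p q r' t' = 0" "excess p q r' t' = 0"
  shows "r = r' \<and> t = t'"
proof -
  have "r = r'"
    using hypercontractive_const_at_critical_point[OF c1(1,2) pq c1(3-5)]
      hypercontractive_const_at_critical_point[OF c2(1,2) pq c2(3-5)] by simp
  then show ?thesis using gap_negative[OF c1(1,2) pq(1) _ c1(3-5), of t'] c2 pq by force
qed

text \<open>With \<open>y = phi r x\<close> the first equation says that the norms agree, and the
  second is the Euler-Lagrange equation. The latter is kept free of denominators: \<open>r\<close>
  may exceed one here, and then the denominator of \<open>phi r\<close> at
  \<open>phi r x powr (q - 1)\<close> is not known to be positive.\<close>

lemma critical_system_iff:
  assumes pq: "1 < p" "1 < q" and x: "0 < x" "x < 1" and r: "0 < r"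
    and pos: "0 < 1 - r + (2 + r) * x" "0 < 1 + 2 * r + 2 * (1 - r) * x"
  shows "critical_system p q x (phi r x) \<longleftrightarrow>
    log_gap p q r x = 0 \<and>
    x powr (p - 1) * (1 + 2 * r + 2 * (1 - r) * phi r x powr (q - 1))
      = 1 - r + (2 + r) * phi r x powr (q - 1)"
proof -
  define y B S where "y = phi r x" and "B = (1 + 2 * r + 2 * (1 - r) * x) / 3"
    and "S = (1 - r + (2 + r) * x) / 3"
  have BS: "0 < B" "0 < S" using pos by (auto simp: B_def S_def)
  have "1 - r + (2 + r) * x = 3 * S" "1 + 2 * r + 2 * (1 - r) * x = 3 * B"
    by (simp_all add: B_def S_def)
  then have y: "y = S / B" by (simp add: phi_def y_def)
  then have "0 < y" using BS by simp
  define P Q where "P = (1 + 2 * x powr p) / 3" and "Q = (1 + 2 * y powr q) / 3"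
  have PQ: "0 < P" "0 < Q" by (auto simp: P_def Q_def intro!: add_pos_nonneg)
  have W: "(B powr q + 2 * S powr q) / 3 = B powr q * Q"
    unfolding Q_def y using BS by (simp add: powr_divide field_simps)
  \<comment> \<open>The operator preserves the mean: \<open>B + 2 * S = 1 + 2 * x\<close>.\<close>
  have "1 + 2 * y = (1 + 2 * x) / B"
    unfolding y using BS by (simp add: field_simps) (simp add: B_def S_def field_simps)
  then have "1 / (1 + 2 * y) * Q powr (1 / q) = 1 / (1 + 2 * x) * (B * Q powr (1 / q))"
    by simp
  also have "B * Q powr (1 / q) = (B powr q * Q) powr (1 / q)"
    using BS PQ pq by (simp add: powr_mult powr_powr)
  finally have "1 / (1 + 2 * x) * P powr (1 / p) = 1 / (1 + 2 * y) * Q powr (1 / q) \<longleftrightarrow>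
      P powr (1 / p) = (B powr q * Q) powr (1 / q)"
    using x by simp
  also have "\<dots> \<longleftrightarrow> ln (P powr (1 / p)) = ln ((B powr q * Q) powr (1 / q))"
    using PQ BS by (subst ln_inj_iff) auto
  also have "\<dots> \<longleftrightarrow> log_gap p q r x = 0"
    unfolding log_gap_def B_def[symmetric] S_def[symmetric] W P_def[symmetric]
    using PQ BS by (auto simp: ln_powr)
  finally have eq1: "1 / (1 + 2 * x) * P powr (1 / p) = 1 / (1 + 2 * y) * Q powr (1 / q) \<longleftrightarrow>
      log_gap p q r x = 0" .
  define X Y where "X = x powr (p - 1)" and "Y = y powr (q - 1)"
  have XY: "0 < X" "0 < Y" using x \<open>0 < y\<close> by (auto simp: X_def Y_def)
  have pw: "x powr p = x * X" "y powr q = y * Y"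
    using x \<open>0 < y\<close> by (auto simp: X_def Y_def powr_diff)
  have den: "0 < 1 + 2 * (x * X)" "0 < 1 + 2 * (y * Y)" "0 < B + 2 * S * Y"
    using XY x \<open>0 < y\<close> BS by (auto intro!: add_pos_pos)
  have "(1 - y) * (1 - Y) / (1 + 2 * (y * Y)) = (B - S) * (1 - Y) / (B + 2 * S * Y)"
  proof -
    have "1 - y = (B - S) / B" "1 + 2 * (y * Y) = (B + 2 * S * Y) / B"
      unfolding y using BS by (simp_all add: field_simps)
    then show ?thesis using BS by simp
  qed
  also have "B - S = r * (1 - x)" by (simp add: B_def S_def field_simps)
  finally have rhs: "(1 - y) * (1 - Y) / (1 + 2 * (y * Y)) = r * (1 - x) * (1 - Y) / (B + 2 * S * Y)" .
  have "(1 - x) * (1 - X) / (1 + 2 * (x * X)) = (1 - y) * (1 - Y) / (1 + 2 * (y * Y)) \<longleftrightarrow>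
      (1 - x) * ((1 - X) * (B + 2 * S * Y)) = (1 - x) * (r * (1 - Y) * (1 + 2 * (x * X)))"
    unfolding rhs using den by (simp add: frac_eq_eq mult_ac)
  also have "\<dots> \<longleftrightarrow> (1 - X) * (B + 2 * S * Y) - r * (1 - Y) * (1 + 2 * (x * X)) = 0"
    using x by simp
  also have "(1 - X) * (B + 2 * S * Y) - r * (1 - Y) * (1 + 2 * (x * X))
      = (1 + 2 * x) / 3 * ((1 - r + (2 + r) * Y) - X * (1 + 2 * r + 2 * (1 - r) * Y))"
    unfolding B_def S_def by (simp add: field_simps)
  also have "\<dots> = 0 \<longleftrightarrow> X * (1 + 2 * r + 2 * (1 - r) * Y) = 1 - r + (2 + r) * Y"
    using x by auto
  finally show ?thesis
    using eq1 unfolding critical_system_def pw[folded y_def] y_def[symmetric]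
    unfolding P_def[symmetric] Q_def[symmetric] X_def[symmetric] Y_def[symmetric]
    using pw unfolding P_def Q_def by simp
qed

lemma excess_zero_iff:
  assumes "0 \<le> r" "r \<le> 1"
  shows "excess p q r t = 0 \<longleftrightarrow>
    exp (- t) powr (p - 1) * (1 + 2 * r + 2 * (1 - r) * phi r (exp (- t)) powr (q - 1))
      = 1 - r + (2 + r) * phi r (exp (- t)) powr (q - 1)"
proof -
  define Y where "Y = phi r (exp (- t)) powr (q - 1)"
  have "0 < Y" using phi_pos(3)[of r "exp (- t)"] assms by (simp add: Y_def)
  have "excess p q r t = 0 \<longleftrightarrow> exp (- ((p - 1) * t)) = exp (- el q r t)"
    by (auto simp: excess_def)
  also have "\<dots> \<longleftrightarrow> exp (- t) powr (p - 1) = phi r Y"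
    unfolding exp_minus_el[OF assms] Y_def by (simp add: powr_def)
  finally show ?thesis
    unfolding Y_def[symmetric] using phi_pos(2)[OF assms \<open>0 < Y\<close>] by (simp add: phi_def field_simps)
qed

lemma phi_inverse:
  assumes "0 < x" "x < 1" "0 < y"
  defines "r \<equiv> (1 + 2 * x) * (1 - y) / ((1 + 2 * y) * (1 - x))"
  shows "phi r x = y" "0 < 1 - r + (2 + r) * x" "0 < 1 + 2 * r + 2 * (1 - r) * x"
proof -
  \<comment> \<open>Preservation of the mean dictates \<open>k\<close>: the numerator
    \<open>k * y\<close> and the denominator \<open>k\<close> of \<open>phi r x\<close> must satisfy
    \<open>k + 2 * (k * y) = 3 * (1 + 2 * x)\<close>.\<close>
  define k where "k = 3 * (1 + 2 * x) / (1 + 2 * y)"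
  have "0 < k" using assms by (auto simp: k_def intro!: divide_pos_pos)
  have "r * (1 - x) = (1 + 2 * x) * (1 - y) / (1 + 2 * y)"
    unfolding r_def using assms by simp
  also have "\<dots> = 1 + 2 * x - k * y"
    unfolding k_def using assms by (simp add: field_simps)
  finally have r: "r * (1 - x) = 1 + 2 * x - k * y" .
  have k: "k * (1 + 2 * y) = 3 * (1 + 2 * x)" unfolding k_def using assms by simp
  have SB: "1 - r + (2 + r) * x = k * y" "1 + 2 * r + 2 * (1 - r) * x = k"
    using r k by (simp_all add: algebra_simps)
  show "phi r x = y" unfolding phi_def SB using \<open>0 < k\<close> by simp
  show "0 < 1 - r + (2 + r) * x" "0 < 1 + 2 * r + 2 * (1 - r) * x"
    unfolding SB using \<open>0 < k\<close> assms by simp_all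
qed

lemma gap_r1_positive:
  assumes "1 < p" "p < q" "0 < t"
  shows "0 < gap p q 1 t"
proof -
  have "psi 1 z = z" for z by (simp add: psi_def phi_def)
  then have "excess p q 1 z = (q - p) * z" for z by (simp add: excess_def el_def algebra_simps)
  then show ?thesis using gap_increasing[of 1 p q 0 t] assms by simp
qed

lemma critical_system_imp_critical_point:
  assumes pq: "1 < p" "p < q" and xy: "x \<in> {0<..<1}" "y \<in> {0<..<1}"
    and sys: "critical_system p q x y"
  defines "r \<equiv> (1 + 2 * x) * (1 - y) / ((1 + 2 * y) * (1 - x))"
  shows "0 < r" "r < 1" "gap p q r (- ln x) = 0" "excess p q r (- ln x) = 0" "phi r x = y"
proof -
  have x: "0 < x" "x < 1" "0 < y" "y < 1" using xy by auto
  show r0: "0 < r" unfolding r_def using x by (intro divide_pos_pos mult_pos_pos) auto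
  note inv = phi_inverse[OF x(1-3), folded r_def]
  show "phi r x = y" by fact
  have "1 < q" using pq by simp
  note sys' = sys[folded inv(1), unfolded critical_system_iff[OF pq(1) this x(1,2) r0 inv(2,3)]]
  then show g: "gap p q r (- ln x) = 0" using x by simp
  \<comment> \<open>At parameter one the gap is positive, and monotonicity past one keeps it
    positive, so it could not vanish.\<close>
  show r1: "r < 1"
  proof (rule ccontr)
    assume "\<not> r < 1"
    then have "log_gap p q 1 x \<le> log_gap p q r x"
      using log_gap_strict_mono[of q x 1 r p] inv x pq by (cases "r = 1") auto
    moreover have "0 < gap p q 1 (- ln x)" using x pq by (intro gap_r1_positive) auto
    ultimately show False using g x by simp
  qed
  show "excess p q r (- ln x) = 0"
    using sys' excess_zero_iff[of r p q "- ln x"] r0 r1 x by simp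
qed

lemma critical_point_imp_critical_system:
  assumes pq: "1 < p" "1 < q"
    and c: "0 < r" "r < 1" "0 < t" "gap p q r t = 0" "excess p q r t = 0"
  shows "critical_system p q (exp (- t)) (phi r (exp (- t)))" "phi r (exp (- t)) \<in> {0<..<1}"
proof -
  let ?x = "exp (- t)"
  have x: "0 < ?x" "?x < 1" using c by auto
  have pos: "0 < 1 - r + (2 + r) * ?x" "0 < 1 + 2 * r + 2 * (1 - r) * ?x" "0 < phi r ?x"
    using phi_pos[of r ?x] c by auto
  show "critical_system p q ?x (phi r ?x)"
    using critical_system_iff[OF pq x c(1) pos(1,2)] excess_zero_iff[of r p q t] c by simp
  have "r * ?x < r * 1" using x c by (intro mult_strict_left_mono) auto
  then have "1 - r + (2 + r) * ?x < 1 + 2 * r + 2 * (1 - r) * ?x"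
    by (simp add: algebra_simps)
  then have "phi r ?x < 1" unfolding phi_def using pos by simp
  then show "phi r ?x \<in> {0<..<1}" using pos by simp
qed

theorem theorem1p2:
  fixes p q :: real
  assumes "1 < p" and "p < q"
  shows "(\<exists>!(x, y) \<in> {0<..<1} \<times> {0<..<1}. critical_system p q x y) \<and>
    (\<forall>(x, y) \<in> {0<..<1} \<times> {0<..<1}. critical_system p q x y \<longrightarrow>
       hypercontractive_const p q = ((1 + 2 * x) * (1 - y)) / ((1 + 2 * y) * (1 - x)) \<and>
       nontrivial_critical_extremizer p q
         (\<lambda>k. 1 + of_real ((1 - x) / (1 + 2 * x)) * (chi k + cnj (chi k))))"
proof
  have "1 < q" using assms by simp
  obtain r t where c: "0 < r" "r < 1" "0 < t" "gap p q r t = 0" "excess p q r t = 0"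
    using critical_point_exists[OF assms] .
  note sol = critical_point_imp_critical_system[OF assms(1) \<open>1 < q\<close> c]
  show "\<exists>!(x, y) \<in> {0<..<1} \<times> {0<..<1}. critical_system p q x y"
  proof (rule ex1I[of _ "(exp (- t), phi r (exp (- t)))"])
    show "case (exp (- t), phi r (exp (- t))) of
      (x, y) \<Rightarrow> (x, y) \<in> {0<..<1} \<times> {0<..<1} \<and> critical_system p q x y"
      using sol c by simp
  next
    fix z :: "real \<times> real"
    assume z: "case z of (x, y) \<Rightarrow> (x, y) \<in> {0<..<1} \<times> {0<..<1} \<and> critical_system p q x y"
    obtain x y where xy: "z = (x, y)" by (cases z)
    with z have x: "x \<in> {0<..<1}" "y \<in> {0<..<1}" "critical_system p q x y" by auto
    note c' = critical_system_imp_critical_point[OF assms x]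
    have "0 < - ln x" using x by simp
    from critical_point_unique[OF assms c'(1,2) this c'(3,4) c]
    show "z = (exp (- t), phi r (exp (- t)))"
      using c'(5) x(1) unfolding xy by auto
  qed
  have main: "hypercontractive_const p q = ((1 + 2 * x) * (1 - y)) / ((1 + 2 * y) * (1 - x)) \<and>
       nontrivial_critical_extremizer p q
         (\<lambda>k. 1 + of_real ((1 - x) / (1 + 2 * x)) * (chi k + cnj (chi k)))"
    if x: "x \<in> {0<..<1}" "y \<in> {0<..<1}" "critical_system p q x y" for x y
  proof -
    define r where "r = (1 + 2 * x) * (1 - y) / ((1 + 2 * y) * (1 - x))"
    note c = critical_system_imp_critical_point[OF assms x, folded r_def]
    have "0 < - ln x" using x by simp
    from hypercontractive_const_at_critical_point[OF c(1,2) assms this c(3,4)]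
    have const: "hypercontractive_const p q = r" .
    define f where "f k = 1 + of_real ((1 - x) / (1 + 2 * x)) * (chi k + cnj (chi k))" for k
    \<comment> \<open>The values of \<open>f\<close> are \<open>s\<close>, \<open>s * x\<close>,
      \<open>s * x\<close>; this scale gives them mean one.\<close>
    define s where "s = 3 / (1 + 2 * x)"
    have "0 < s" "0 < x" "x < 1" using x by (auto simp: s_def)
    have u: "1 + (1 - x) / (1 + 2 * x) * 2 = s" "1 - (1 - x) / (1 + 2 * x) = s * x"
      using \<open>0 < x\<close> by (simp_all add: s_def field_simps)
    have "1 + of_real v * (chi 0 + cnj (chi 0)) = of_real (1 + v * 2)"
      "1 + of_real v * (chi 1 + cnj (chi 1)) = of_real (1 - v)"
      "1 + of_real v * (chi 2 + cnj (chi 2)) = of_real (1 - v)" for v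
      unfolding chi_values by (simp_all add: complex_eq_iff)
    note f = this[of "(1 - x) / (1 + 2 * x)", unfolded u, folded f_def]
    have "\<not> (\<exists>k. \<forall>j. f j = k)"
    proof
      assume "\<exists>k. \<forall>j. f j = k"
      then have "f 0 = f 1" by metis
      then have "s = s * x" unfolding f of_real_eq_iff .
      then show False using \<open>0 < s\<close> \<open>x < 1\<close> by simp
    qed
    moreover have "Lp_norm q (T_op r f) = Lp_norm p f"
    proof -
      note gap = log_gap_eq_Lp_norms[OF f \<open>0 < s\<close> \<open>0 < x\<close> assms(1) \<open>1 < q\<close>, of r]
      have "ln (Lp_norm q (T_op r f) / Lp_norm p f) = 0" using gap(1) c \<open>0 < x\<close> by simp
      then have "Lp_norm q (T_op r f) / Lp_norm p f = 1"
        using gap(2,3) c by (subst (asm) ln_eq_zero_iff) auto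
      then show ?thesis by simp
    qed
    ultimately show ?thesis
      unfolding nontrivial_critical_extremizer_def const f_def[symmetric] r_def[symmetric] by simp
  qed
  show "\<forall>(x, y) \<in> {0<..<1} \<times> {0<..<1}. critical_system p q x y \<longrightarrow>
       hypercontractive_const p q = ((1 + 2 * x) * (1 - y)) / ((1 + 2 * y) * (1 - x)) \<and>
       nontrivial_critical_extremizer p q
         (\<lambda>k. 1 + of_real ((1 - x) / (1 + 2 * x)) * (chi k + cnj (chi k)))"
    unfolding Ball_def split_paired_All prod.case mem_Times_iff fst_conv snd_conv
    using main by blast
qed

end
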